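(* Let $E$ be a real vector space of real-valued functions on $\mathbb{R}$ such that every $f\in E$ is ultimately analytic and $germ(f)$ belongs to a Hardy field $\mathcal{H}=\mathcal{H}_E$ (the same Hardy field for all $f \in E$). Assume that $E$ is closed under all real translations, i.e., $f\in E$ and $\alpha\in\mathbb{R}$ imply that $x\mapsto f(x-\alpha)$ is in $E$. Let $\mathcal{E}$ be the complex vector space generated by $E$. Then for each $g\in\mathcal{E}\cap L^2(\mathbb{R})\setminus\{0\}$ and every finite set $\Lambda=\{(\alpha_k,\beta_k)\}_{k=1}^N$ of distinct points of $\mathbb{R}^2$, the finite Gabor system $\mathcal{G}(g,\Lambda)=\{e^{2\pi i\beta_kx}g(x-\alpha_k)\}_{k=1}^N$ is linearly independent in $L^2(\mathbb{R})$.
   Context: $L^2(\mathbb{R})$ is the space of complex-valued square-integrable functions on $\mathbb{R}$, identified when equal almost everywhere. Linear independence of $\mathcal{G}(g,\Lambda)$ means: if $c_1,\dots,c_N\in\mathbb{C}$ and $\sum_{k=1}^N c_k e^{2\pi i\beta_kx}g(x-\alpha_k)=0$ for almost every $x$, then $c_1=\dots=c_N=0$. A property $P(x)$ holds ultimately if there is $x_0\in\mathbb{R}$ such that $P(x)$ holds for all $x>x_0$; in particular $f$ is ultimately analytic if it is (real-)analytic on some interval $(A,\infty)$. Let $F$ be the set of all functions $f:X_f\to\mathbb{R}$ with $(a_f,\infty)\subseteq X_f\subseteq\mathbb{R}$ for some $a_f\in\mathbb{R}$. Write $f\sim g$ if $f(x)=g(x)$ for all sufficiently large $x$. The equivalence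 class of $f$ is $germ(f)$; the set $\mathcal{F}$ of all germs is a commutative ring under pointwise addition and multiplication. A Hardy field is a subring $\mathcal{H}$ of $\mathcal{F}$ that is a field and is closed under differentiation (every $germ(f)\in\mathcal{H}$ has $f$ ultimately differentiable with $germ(f')\in\mathcal{H}$). *)

theory Defs
  imports "HOL-Analysis.Analysis" "HOL-Library.Function_Algebras"
begin

section \<open>Germs at infinity\<close>

text \<open>
  Germs are built from total functions.  A function defined only on a set containing some
  ray $(a, \infty)$ has the same germ as any of its extensions to the real line, so nothing is lost.
\<close>

definition ultimately_eq :: "(real \<Rightarrow> real) \<Rightarrow> (real \<Rightarrow> real) \<Rightarrow> bool" where
  "ultimately_eq f g \<longleftrightarrow> (\<exists>x0. \<forall>x>x0. f x = g x)"

lemma ultimately_eq_iff: "ultimately_eq f g \<longleftrightarrow> (\<forall>\<^sub>F x in at_top. f x = g x)"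
  by (simp add: ultimately_eq_def eventually_at_top_dense)

quotient_type germ = "real \<Rightarrow> real" / ultimately_eq
  morphisms rep_germ germ
proof (rule equivpI)
  show "reflp ultimately_eq" by (simp add: reflp_def ultimately_eq_iff)
  show "symp ultimately_eq" by (auto simp: symp_def ultimately_eq_iff elim: eventually_mono)
  show "transp ultimately_eq"
    by (auto simp: transp_def ultimately_eq_iff elim: eventually_elim2)
qed

instantiation germ :: comm_ring_1
begin

lift_definition zero_germ :: germ is "\<lambda>_. 0" .
lift_definition one_germ :: germ is "\<lambda>_. 1" .
lift_definition plus_germ :: "germ \<Rightarrow> germ \<Rightarrow> germ" is "\<lambda>f g x. f x + g x"
  by (auto simp: ultimately_eq_iff elim: eventually_elim2)
lift_definition minus_germ :: "germ \<Rightarrow> germ \<Rightarrow> germ" is "\<lambda>f g x. f x - g x"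
  by (auto simp: ultimately_eq_iff elim: eventually_elim2)
lift_definition times_germ :: "germ \<Rightarrow> germ \<Rightarrow> germ" is "\<lambda>f g x. f x * g x"
  by (auto simp: ultimately_eq_iff elim: eventually_elim2)
lift_definition uminus_germ :: "germ \<Rightarrow> germ" is "\<lambda>f x. - f x"
  by (auto simp: ultimately_eq_iff elim: eventually_mono)

instance
  by standard (transfer; simp add: ultimately_eq_iff algebra_simps)+

end

definition hardy_field :: "germ set \<Rightarrow> bool" where
  "hardy_field H \<longleftrightarrow>
     1 \<in> H \<and> (\<forall>a\<in>H. \<forall>b\<in>H. a - b \<in> H \<and> a * b \<in> H) \<and>
     (\<forall>a\<in>H. a \<noteq> 0 \<longrightarrow> (\<exists>b\<in>H. a * b = 1)) \<and>
     (\<forall>f. germ f \<in> H \<longrightarrow>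
        (\<exists>x0. \<forall>x>x0. f differentiable at x) \<and> germ (deriv f) \<in> H)"


section \<open>Real analyticity\<close>

text \<open>The library's \<open>analytic_on\<close> is complex analyticity.\<close>

definition real_analytic_on :: "(real \<Rightarrow> real) \<Rightarrow> real set \<Rightarrow> bool" where
  "real_analytic_on f S \<longleftrightarrow> (\<forall>x\<in>S. \<exists>F. (\<lambda>h. f (x + h)) has_fps_expansion F)"

definition ultimately_analytic :: "(real \<Rightarrow> real) \<Rightarrow> bool" where
  "ultimately_analytic f \<longleftrightarrow> (\<exists>A. real_analytic_on f {A<..})"


section \<open>Vector spaces of scalar functions\<close>

definition fun_scale :: "'k::field \<Rightarrow> ('a \<Rightarrow> 'k) \<Rightarrow> ('a \<Rightarrow> 'k)" where
  "fun_scale c f = (\<lambda>x. c * f x)"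

interpretation fun_space: vector_space "fun_scale :: 'k::field \<Rightarrow> ('a \<Rightarrow> 'k) \<Rightarrow> _"
  by unfold_locales (auto simp: fun_scale_def fun_eq_iff algebra_simps)

definition complexification :: "('a \<Rightarrow> real) set \<Rightarrow> ('a \<Rightarrow> complex) set" where
  "complexification E = fun_space.span ((\<lambda>f x. complex_of_real (f x)) ` E)"


section \<open>Square-integrable functions and Gabor systems\<close>

text \<open>
  Functions represent their almost-everywhere classes, so being nonzero in $L^2$ and linear
  relations in $L^2$ are expressed up to null sets.
\<close>

definition L2 :: "(real \<Rightarrow> complex) set" where
  "L2 = {g \<in> borel_measurable lebesgue. integrable lebesgue (\<lambda>x. (cmod (g x))\<^sup>2)}"

definition gabor :: "(real \<Rightarrow> complex) \<Rightarrow> real \<times> real \<Rightarrow> real \<Rightarrow> complex" where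
  "gabor g = (\<lambda>(\<alpha>, \<beta>) x. exp (2 * of_real pi * \<i> * of_real \<beta> * of_real x) * g (x - \<alpha>))"

text \<open>Independence of an indexed family, so coinciding members count as dependent.\<close>

definition L2_independent :: "'i set \<Rightarrow> ('i \<Rightarrow> real \<Rightarrow> complex) \<Rightarrow> bool" where
  "L2_independent I f \<longleftrightarrow>
     (\<forall>c. (AE x in lebesgue. (\<Sum>i\<in>I. c i * f i x) = 0) \<longrightarrow> (\<forall>i\<in>I. c i = 0))"

end

theory Submission
  imports Defs "HOL-Complex_Analysis.Complex_Analysis" "HOL-Probability.Probability"
    "HOL-Real_Asymp.Real_Asymp"
begin

text \<open>
  Group a linear relation among the time-frequency shifts by frequency: the sum of
  \<open>exp (2 pi i \<beta> x) h_\<beta> (x)\<close> vanishes almost everywhere, where \<open>h_\<beta>\<close> is a combination of translates of \<open>g\<close>.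
  The real and imaginary parts of the \<open>h_\<beta>\<close> lie in the Hardy field, so after division by the dominant
  one they converge, and a trigonometric polynomial tending to zero has zero coefficients; hence every
  \<open>h_\<beta>\<close> vanishes ultimately. These relations continue the analytic function \<open>g\<close> from a neighbourhood of
  infinity to the left, step by step, and the original relation shows that the continuation agrees with
  \<open>g\<close> almost everywhere. Thus every \<open>h_\<beta>\<close> vanishes almost everywhere on the whole line.

  It remains to see that translates of a nonzero square-integrable function are independent. Cut \<open>g\<close> at
  the origin into \<open>g_+\<close> and \<open>g_-\<close>. The combination of translates of \<open>g_+\<close> equals minus that of \<open>g_-\<close> and
  has compact support, so its Laplace transform \<open>Q\<close> is entire, and \<open>Q = P L(g_+)\<close> on the right,
  \<open>Q = - P L(g_-)\<close> on the left half-plane, with an exponential polynomial \<open>P\<close>. By Cauchy-Schwarz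
  \<open>\<bar>Q / P\<bar> \<le> C / sqrt \<bar>Re s\<bar>\<close>. This excludes poles, and the maximum principle gives \<open>Q = 0\<close>.
\<close>

section \<open>Trigonometric polynomials\<close>

text \<open>Translating by \<open>t\<close> and subtracting \<open>cis (b i * t)\<close> times the
  original sum removes the term \<open>i\<close>, so the induction hypothesis applies to the rest.
  Once all other coefficients are 0, the remaining term has the constant modulus
  \<open>norm (c i)\<close>.\<close>

lemma trig_poly_tendsto_0:
  fixes b :: "'i \<Rightarrow> real" and c :: "'i \<Rightarrow> complex"
  assumes "finite J" "inj_on b J" "((\<lambda>x. \<Sum>j\<in>J. c j * cis (b j * x)) \<longlongrightarrow> 0) at_top" "j \<in> J"
  shows "c j = 0"
  using assms
proof (induction J arbitrary: c j rule: finite_induct)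
  case empty
  then show ?case by simp
next
  case (insert i J)
  let ?f = "\<lambda>x. \<Sum>j\<in>insert i J. c j * cis (b j * x)"
  have lim: "((\<lambda>x. ?f (x + t)) \<longlongrightarrow> 0) at_top" for t
    by (rule filterlim_compose[OF insert.prems(2)])
       (subst add.commute, intro filterlim_tendsto_add_at_top[OF tendsto_const] filterlim_ident)
  have J: "c j = 0" if j: "j \<in> J" for j
  proof -
    \<comment> \<open>This choice makes \<open>cis (b j * t)\<close> the negative of
      \<open>cis (b i * t)\<close>, so the coefficient of \<open>j\<close> is multiplied by a
      nonzero factor.\<close>
    define t where "t = pi / (b j - b i)"
    have ne: "b j \<noteq> b i"
      using insert.prems(1) insert.hyps j by (auto simp: inj_on_def)
    have "((\<lambda>x. ?f (x + t) - cis (b i * t) * ?f x) \<longlongrightarrow> 0 - cis (b i * t) * 0) at_top"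
      by (intro tendsto_intros lim insert.prems(2))
    moreover have "?f (x + t) - cis (b i * t) * ?f x
        = (\<Sum>j\<in>J. (c j * (cis (b j * t) - cis (b i * t))) * cis (b j * x))" for x
      using insert.hyps
      by (simp add: sum_distrib_left ring_distribs cis_mult[symmetric] sum_subtractf mult_ac)
    ultimately have "((\<lambda>x. \<Sum>j\<in>J. (c j * (cis (b j * t) - cis (b i * t))) * cis (b j * x)) \<longlongrightarrow> 0) at_top"
      by simp
    from insert.IH[OF _ this j] insert.prems(1)
    have "c j = 0 \<or> cis (b j * t) = cis (b i * t)" by auto
    moreover have "cis (b j * t) = cis (b i * t) * cis pi"
      using ne by (simp add: cis_mult t_def field_simps del: cis_pi)
    ultimately show ?thesis by auto
  qed
  show ?case
  proof (cases "j = i")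
    case True
    have "((\<lambda>x. c i * cis (b i * x)) \<longlongrightarrow> 0) at_top"
      using insert.prems(2) insert.hyps J by simp
    from tendsto_norm[OF this] have "((\<lambda>x::real. norm (c i)) \<longlongrightarrow> 0) at_top"
      by (simp add: norm_mult)
    then show ?thesis using True
      by (simp add: tendsto_const_iff)
  qed (use insert.prems(3) J in auto)
qed

text \<open>The zeros of an entire function that is not identically zero are countable, and
  \<open>x\<close> determines \<open>of_real x * z\<close> injectively, so the exceptional set is
  countable and hence null.\<close>

lemma AE_entire_nonzero:
  fixes f :: "complex \<Rightarrow> complex" and z :: complex
  assumes "f holomorphic_on UNIV" "f w \<noteq> 0" "z \<noteq> 0"
  shows "AE x in lborel. f (of_real x * z) \<noteq> 0"
proof -
  have "countable {w \<in> UNIV. f w = 0}"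
  proof (cases "f constant_on UNIV")
    case True
    then have "{w \<in> UNIV. f w = 0} = {}" using assms(2) by (auto simp: constant_on_def)
    then show ?thesis by simp
  next
    case False
    then show ?thesis
      using holomorphic_countable_zeros[OF assms(1)] by (auto simp: constant_on_def)
  qed
  moreover have "inj (\<lambda>x::real. of_real x * z)"
    using assms(3) by (auto simp: inj_on_def)
  ultimately have "countable ((\<lambda>x::real. of_real x * z) -` {w \<in> UNIV. f w = 0})"
    by (metis (no_types) countable_image_inj_on image_vimage_subset inj_on_subset countable_subset subset_UNIV)
  then show ?thesis
    by (intro AE_I'[OF countable_imp_null_set_lborel]) auto
qed

lemma trig_poly_nonzero:
  fixes b :: "'i \<Rightarrow> real" and c :: "'i \<Rightarrow> complex"
  assumes "finite J" "inj_on b J" "j \<in> J" "c j \<noteq> 0"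
  obtains x where "(\<Sum>j\<in>J. c j * cis (b j * x)) \<noteq> 0"
proof (rule ccontr)
  assume "\<not> thesis"
  then have "(\<Sum>j\<in>J. c j * cis (b j * x)) = 0" for x
    using that[of x] by argo
  then have "((\<lambda>x. \<Sum>j\<in>J. c j * cis (b j * x)) \<longlongrightarrow> 0) at_top"
    by (simp only: tendsto_const)
  from trig_poly_tendsto_0[OF assms(1,2) this assms(3)] assms(4) show False by simp
qed

text \<open>The trigonometric polynomial is the restriction of an entire exponential sum to the
  imaginary axis.\<close>

lemma AE_trig_poly_nonzero:
  fixes b :: "'i \<Rightarrow> real" and c :: "'i \<Rightarrow> complex"
  assumes "finite J" "inj_on b J" "j \<in> J" "c j \<noteq> 0"
  shows "AE x in lborel. (\<Sum>j\<in>J. c j * cis (b j * x)) \<noteq> 0"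
proof -
  define f where "f = (\<lambda>w. \<Sum>j\<in>J. c j * exp (of_real (b j) * w))"
  have f: "f (of_real x * \<i>) = (\<Sum>j\<in>J. c j * cis (b j * x))" for x
    by (simp add: f_def cis_conv_exp mult_ac)
  obtain x where x: "(\<Sum>j\<in>J. c j * cis (b j * x)) \<noteq> 0"
    using trig_poly_nonzero[where J = J and b = b and c = c and j = j] assms by blast
  have "f holomorphic_on UNIV"
    unfolding f_def by (intro holomorphic_intros)
  from AE_entire_nonzero[OF this x[folded f] complex_i_not_zero]
  show ?thesis unfolding f .
qed

section \<open>Hardy fields\<close>

lemma germ_eq_iff: "germ f = germ g \<longleftrightarrow> (\<forall>\<^sub>F x in at_top. f x = g x)"
  by (simp add: germ.abs_eq_iff ultimately_eq_iff)

lemma hardy_fieldD: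
  assumes "hardy_field H"
  shows "germ f \<in> H \<Longrightarrow> germ g \<in> H \<Longrightarrow> germ (\<lambda>x. f x - g x) \<in> H"
    and "germ f \<in> H \<Longrightarrow> germ g \<in> H \<Longrightarrow> germ (\<lambda>x. f x * g x) \<in> H"
    and "germ f \<in> H \<Longrightarrow> \<forall>\<^sub>F x in at_top. f differentiable at x"
    and "germ f \<in> H \<Longrightarrow> germ (deriv f) \<in> H"
  using assms unfolding hardy_field_def
  by (auto simp: eventually_at_top_dense simp flip: minus_germ.abs_eq times_germ.abs_eq)

text \<open>The field axiom is used through this form: a function with nonzero germ in
  \<open>H\<close> has no zeros at all beyond some point.\<close>

lemma hardy_field_inverse:
  assumes "hardy_field H" "germ f \<in> H" "\<not> (\<forall>\<^sub>F x in at_top. f x = 0)"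
  obtains u where "germ u \<in> H" "\<forall>\<^sub>F x in at_top. f x * u x = 1"
proof -
  have "germ f \<noteq> 0"
    using assms(3) by (simp add: zero_germ_def germ_eq_iff)
  then obtain b where b: "b \<in> H" "germ f * b = 1"
    using assms unfolding hardy_field_def by blast
  obtain u where "b = germ u"
    by (metis Quotient3_abs_rep Quotient3_germ)
  with b show ?thesis
    using that by (auto simp: times_germ.abs_eq one_germ_def germ_eq_iff)
qed

lemma eventually_constant_sign:
  fixes f :: "real \<Rightarrow> real"
  assumes "\<forall>\<^sub>F x in at_top. isCont f x" "\<forall>\<^sub>F x in at_top. f x \<noteq> 0"
  shows "(\<forall>\<^sub>F x in at_top. f x > 0) \<or> (\<forall>\<^sub>F x in at_top. f x < 0)"
proof -
  obtain a where a: "\<And>x. x > a \<Longrightarrow> isCont f x" "\<And>x. x > a \<Longrightarrow> f x \<noteq> 0"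
    using eventually_conj[OF assms] by (auto simp: eventually_at_top_dense)
  have "connected (f ` {a<..})"
    by (intro connected_continuous_image continuous_at_imp_continuous_on) (use a in auto)
  moreover have "0 \<notin> f ` {a<..}"
    using a by auto
  ultimately have "\<not> (\<exists>x>a. \<exists>y>a. f x < 0 \<and> 0 < f y)"
    by (meson connectedD_interval greaterThan_iff imageI less_imp_le)
  then have "(\<forall>x>a. f x > 0) \<or> (\<forall>x>a. f x < 0)"
    using a(2) by (metis linorder_neqE_linordered_idom)
  then show ?thesis
    by (auto simp: eventually_at_top_dense)
qed

text \<open>The inverse germ excludes zeros near infinity and differentiability gives continuity, so
  the intermediate value theorem fixes the sign.\<close>

lemma hardy_field_sign:
  assumes "hardy_field H" "germ f \<in> H"
  shows "(\<forall>\<^sub>F x in at_top. f x = 0) \<or> (\<forall>\<^sub>F x in at_top. f x > 0) \<or> (\<forall>\<^sub>F x in at_top. f x < 0)"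
proof (cases "\<forall>\<^sub>F x in at_top. f x = 0")
  case False
  then obtain u where "\<forall>\<^sub>F x in at_top. f x * u x = 1"
    using hardy_field_inverse[OF assms] by metis
  then have "\<forall>\<^sub>F x in at_top. f x \<noteq> 0"
    by eventually_elim auto
  moreover have "\<forall>\<^sub>F x in at_top. isCont f x"
    using hardy_fieldD(3)[OF assms]
    by eventually_elim (simp add: differentiable_imp_continuous_within)
  ultimately show ?thesis
    using eventually_constant_sign by blast
qed simp

lemma mono_bounded_tendsto_at_top:
  fixes f :: "real \<Rightarrow> real"
  assumes mono: "\<And>x y. a < x \<Longrightarrow> x \<le> y \<Longrightarrow> f x \<le> f y"
    and bd: "\<And>x. a < x \<Longrightarrow> f x \<le> B"
  shows "\<exists>l. (f \<longlongrightarrow> l) at_top"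
proof (intro exI increasing_tendsto)
  have bdd: "bdd_above (f ` {a<..})"
    using bd by (auto simp: bdd_above_def)
  show "\<forall>\<^sub>F x in at_top. f x \<le> Sup (f ` {a<..})"
    using eventually_gt_at_top[of a] by eventually_elim (auto intro: cSup_upper bdd)
  fix l assume "l < Sup (f ` {a<..})"
  then obtain y where y: "y > a" "l < f y"
    using less_cSup_iff[OF _ bdd, of l] by auto
  show "\<forall>\<^sub>F x in at_top. l < f x"
    using eventually_ge_at_top[of y] by eventually_elim (use y mono in force)
qed

text \<open>The derivative has its germ in \<open>H\<close> too, hence a constant sign near
  infinity, so \<open>f\<close> is ultimately monotone and bounded. The fact \<open>*\<close> treats
  the nondecreasing case; the other one is reduced to it by negation.\<close>

lemma hardy_field_bounded_tendsto:
  assumes "hardy_field H" "germ f \<in> H" "\<forall>\<^sub>F x in at_top. \<bar>f x\<bar> \<le> B"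
  shows "\<exists>l. (f \<longlongrightarrow> l) at_top"
proof -
  have *: "\<exists>l. (h \<longlongrightarrow> l) at_top"
    if h: "\<forall>\<^sub>F x in at_top. h differentiable at x" "\<forall>\<^sub>F x in at_top. deriv h x \<ge> 0"
      "\<forall>\<^sub>F x in at_top. \<bar>h x\<bar> \<le> B" for h :: "real \<Rightarrow> real"
  proof -
    obtain a where a: "\<And>x. x > a \<Longrightarrow> h differentiable at x" "\<And>x. x > a \<Longrightarrow> deriv h x \<ge> 0"
      "\<And>x. x > a \<Longrightarrow> \<bar>h x\<bar> \<le> B"
      using eventually_conj[OF h(1) eventually_conj[OF h(2,3)]]
      by (auto simp: eventually_at_top_dense)
    show ?thesis
    proof (rule mono_bounded_tendsto_at_top)
      fix x y assume xy: "a < x" "x \<le> y"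
      show "h x \<le> h y"
      proof (rule DERIV_nonneg_imp_nondecreasing[OF xy(2)])
        fix z assume "x \<le> z" "z \<le> y"
        then show "\<exists>d. DERIV h z :> d \<and> d \<ge> 0"
          using a xy by (intro exI[of _ "deriv h z"]) (auto simp: DERIV_deriv_iff_real_differentiable)
      qed
    next
      fix x assume "a < x"
      then show "h x \<le> B" using a(3)[of x] by simp
    qed
  qed
  note d = hardy_fieldD(3)[OF assms(1,2)]
  have "(\<forall>\<^sub>F x in at_top. deriv f x \<ge> 0) \<or> (\<forall>\<^sub>F x in at_top. deriv f x \<le> 0)"
    using hardy_field_sign[OF assms(1) hardy_fieldD(4)[OF assms(1,2)]]
    by (smt (verit) eventually_mono)
  then show ?thesis
  proof
    assume "\<forall>\<^sub>F x in at_top. deriv f x \<le> 0"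
    with d have "\<forall>\<^sub>F x in at_top. deriv (\<lambda>x. - f x) x \<ge> 0"
      by eventually_elim (metis DERIV_deriv_iff_real_differentiable DERIV_imp_deriv DERIV_minus neg_0_le_iff_le)
    moreover have "\<forall>\<^sub>F x in at_top. (\<lambda>x. - f x) differentiable at x"
      using d by eventually_elim (rule differentiable_minus)
    ultimately obtain l where "((\<lambda>x. - f x) \<longlongrightarrow> l) at_top"
      using *[of "\<lambda>x. - f x"] assms(3) by auto
    from tendsto_minus[OF this] show ?thesis by auto
  qed (use * d assms(3) in blast)
qed

text \<open>Comparing squares keeps the argument inside the ring: the sign of
  \<open>f x * f x - g x * g x\<close> is decided by \<open>hardy_field_sign\<close>.\<close>

lemma hardy_field_abs_le_cases:
  assumes "hardy_field H" "germ f \<in> H" "germ g \<in> H"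
  shows "(\<forall>\<^sub>F x in at_top. \<bar>f x\<bar> \<le> \<bar>g x\<bar>) \<or> (\<forall>\<^sub>F x in at_top. \<bar>g x\<bar> \<le> \<bar>f x\<bar>)"
proof -
  have "germ (\<lambda>x. f x * f x - g x * g x) \<in> H"
    using assms by (intro hardy_fieldD)
  from hardy_field_sign[OF assms(1) this]
  have "(\<forall>\<^sub>F x in at_top. f x * f x \<le> g x * g x) \<or> (\<forall>\<^sub>F x in at_top. g x * g x \<le> f x * f x)"
    by (smt (verit) eventually_mono)
  then show ?thesis
    by (simp add: abs_le_square_iff power2_eq_square)
qed

lemma hardy_field_dominant:
  assumes "hardy_field H" "finite F" "F \<noteq> {}" "\<And>f. f \<in> F \<Longrightarrow> germ f \<in> H"
  shows "\<exists>m\<in>F. \<forall>f\<in>F. \<forall>\<^sub>F x in at_top. \<bar>f x\<bar> \<le> \<bar>m x\<bar>"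
  using assms(2-)
proof (induction F rule: finite_ne_induct)
  case (singleton f)
  then show ?case by simp
next
  case (insert f F)
  then obtain m where m: "m \<in> F" "\<And>g. g \<in> F \<Longrightarrow> \<forall>\<^sub>F x in at_top. \<bar>g x\<bar> \<le> \<bar>m x\<bar>"
    by blast
  from insert.prems m(1) have "germ f \<in> H" "germ m \<in> H" by auto
  from hardy_field_abs_le_cases[OF assms(1) this] show ?case
  proof
    assume fm: "\<forall>\<^sub>F x in at_top. \<bar>f x\<bar> \<le> \<bar>m x\<bar>"
    show ?thesis using fm m by (intro bexI[of _ m]) auto
  next
    assume mf: "\<forall>\<^sub>F x in at_top. \<bar>m x\<bar> \<le> \<bar>f x\<bar>"
    have "\<forall>\<^sub>F x in at_top. \<bar>g x\<bar> \<le> \<bar>f x\<bar>" if "g \<in> F" for g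
      using m(2)[OF that] mf by eventually_elim simp
    then show ?thesis by (intro bexI[of _ f]) auto
  qed
qed

text \<open>After division by the dominant real or imaginary part the coefficients converge, and their
  limits form a trigonometric polynomial that vanishes at infinity.\<close>
lemma hardy_field_trig_independent:
  fixes h :: "'i \<Rightarrow> real \<Rightarrow> complex" and b :: "'i \<Rightarrow> real"
  assumes H: "hardy_field H" and J: "finite J" "inj_on b J"
    and germs: "\<And>j. j \<in> J \<Longrightarrow> germ (\<lambda>x. Re (h j x)) \<in> H \<and> germ (\<lambda>x. Im (h j x)) \<in> H"
    and zero: "\<forall>\<^sub>F x in at_top. (\<Sum>j\<in>J. h j x * cis (b j * x)) = 0"
    and j: "j \<in> J"
  shows "\<forall>\<^sub>F x in at_top. h j x = 0"
proof -
  \<comment> \<open>The Hardy field orders real germs only, so the dominant function is sought among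
    the real and imaginary parts.\<close>
  define F where "F = (\<lambda>j x. Re (h j x)) ` J \<union> (\<lambda>j x. Im (h j x)) ` J"
  have "finite F" "F \<noteq> {}" "\<And>f. f \<in> F \<Longrightarrow> germ f \<in> H"
    using J j germs by (auto simp: F_def)
  from hardy_field_dominant[OF H this]
  obtain m where m: "m \<in> F" "\<And>f. f \<in> F \<Longrightarrow> \<forall>\<^sub>F x in at_top. \<bar>f x\<bar> \<le> \<bar>m x\<bar>"
    by blast
  have mH: "germ m \<in> H"
    using m(1) germs by (auto simp: F_def)
  have RI: "\<And>j. j \<in> J \<Longrightarrow> (\<lambda>x. Re (h j x)) \<in> F" "\<And>j. j \<in> J \<Longrightarrow> (\<lambda>x. Im (h j x)) \<in> F"
    by (auto simp: F_def)
  have m0: "\<forall>\<^sub>F x in at_top. m x = 0"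
  proof (rule ccontr)
    assume "\<not> ?thesis"
    from hardy_field_inverse[OF H mH this]
    obtain u where u: "germ u \<in> H" "\<forall>\<^sub>F x in at_top. m x * u x = 1" by metis
    have lim: "\<exists>l. ((\<lambda>x. f x * u x) \<longlongrightarrow> l) at_top" if f: "f \<in> F" for f
    proof (rule hardy_field_bounded_tendsto[OF H])
      have "germ f \<in> H"
        using f germs by (auto simp: F_def)
      then show "germ (\<lambda>x. f x * u x) \<in> H"
        using u(1) hardy_fieldD(2)[OF H] by blast
      show "\<forall>\<^sub>F x in at_top. \<bar>f x * u x\<bar> \<le> 1"
        using m(2)[OF f] u(2)
      proof eventually_elim
        case (elim x)
        then have "\<bar>f x * u x\<bar> \<le> \<bar>m x * u x\<bar>"
          unfolding abs_mult by (intro mult_right_mono) auto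
        also have "\<bar>m x * u x\<bar> = 1"
          using elim by simp
        finally show ?case .
      qed
    qed
    have "\<exists>l. ((\<lambda>x. h j x * of_real (u x)) \<longlongrightarrow> l) at_top" if j: "j \<in> J" for j
    proof -
      from lim[OF RI(1)[OF j]] lim[OF RI(2)[OF j]] obtain p q where
        "((\<lambda>x. Re (h j x) * u x) \<longlongrightarrow> p) at_top" "((\<lambda>x. Im (h j x) * u x) \<longlongrightarrow> q) at_top" by blast
      then show ?thesis
        by (intro exI[of _ "Complex p q"]) (simp add: tendsto_complex_iff)
    qed
    then have "\<exists>L. \<forall>j\<in>J. ((\<lambda>x. h j x * of_real (u x)) \<longlongrightarrow> L j) at_top"
      by (intro bchoice ballI)
    then obtain L where L: "\<And>j. j \<in> J \<Longrightarrow> ((\<lambda>x. h j x * of_real (u x)) \<longlongrightarrow> L j) at_top"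
      by blast
    \<comment> \<open>The factors \<open>cis (b j * x)\<close> need not converge but have modulus 1,
      so replacing each coefficient by its limit costs an error tending to 0. The given relation,
      multiplied by \<open>u x\<close>, then leaves only the sum with coefficients
      \<open>L j\<close>.\<close>
    have "((\<lambda>x. \<Sum>j\<in>J. (L j - h j x * of_real (u x)) * cis (b j * x)) \<longlongrightarrow> (\<Sum>j\<in>J. 0)) at_top"
    proof (intro tendsto_sum)
      fix j assume j: "j \<in> J"
      from tendsto_norm[OF tendsto_diff[OF tendsto_const[of "L j"] L[OF j]]]
      have "((\<lambda>x. norm ((L j - h j x * of_real (u x)) * cis (b j * x))) \<longlongrightarrow> 0) at_top"
        by (simp add: norm_mult)
      then show "((\<lambda>x. (L j - h j x * of_real (u x)) * cis (b j * x)) \<longlongrightarrow> 0) at_top"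
        by (rule tendsto_norm_zero_cancel)
    qed
    moreover have "\<forall>\<^sub>F x in at_top. (\<Sum>j\<in>J. (L j - h j x * of_real (u x)) * cis (b j * x))
        = (\<Sum>j\<in>J. L j * cis (b j * x))"
      using zero
    proof eventually_elim
      case (elim x)
      have "(\<Sum>j\<in>J. (L j - h j x * of_real (u x)) * cis (b j * x))
          = (\<Sum>j\<in>J. L j * cis (b j * x)) - (\<Sum>j\<in>J. h j x * cis (b j * x)) * of_real (u x)"
        by (simp add: sum_distrib_left sum_subtractf ring_distribs mult_ac)
      then show ?case using elim by simp
    qed
    ultimately have "((\<lambda>x. \<Sum>j\<in>J. L j * cis (b j * x)) \<longlongrightarrow> 0) at_top"
      by (simp add: Lim_transform_eventually)
    then have L0: "L j = 0" if "j \<in> J" for j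
      using trig_poly_tendsto_0[OF J _ that] by blast
    have "((\<lambda>x. Re (h j x) * u x) \<longlongrightarrow> 0) at_top" "((\<lambda>x. Im (h j x) * u x) \<longlongrightarrow> 0) at_top"
      if "j \<in> J" for j
      using L[OF that] unfolding L0[OF that] by (simp_all add: tendsto_complex_iff)
    \<comment> \<open>The function \<open>m\<close> is itself one of the real or imaginary parts, so
      normalising by it cannot make every limit vanish.\<close>
    then have "((\<lambda>x. m x * u x) \<longlongrightarrow> 0) at_top"
      using m(1) unfolding F_def by blast
    moreover have "((\<lambda>x. m x * u x) \<longlongrightarrow> 1) at_top"
      using u(2) by (simp add: tendsto_eventually)
    ultimately show False
      using tendsto_unique[of at_top] by force
  qed
  from m(2)[OF RI(1)[OF j]] m(2)[OF RI(2)[OF j]] m0 show ?thesis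
    by eventually_elim (simp add: complex_eq_iff)
qed

section \<open>Real analytic functions\<close>

text \<open>Otherwise dividing by \<open>x ^ n\<close>, with \<open>n\<close> the subdegree, gives a
  function with nonzero limit at 0, and \<open>f\<close> has no zeros in a punctured neighbourhood.
  Frequent zeros suffice, so they may accumulate from one side only.\<close>

lemma has_fps_expansion_eq_0I:
  fixes f :: "real \<Rightarrow> real"
  assumes F: "f has_fps_expansion F" and freq: "\<exists>\<^sub>F x in at 0. f x = 0"
  shows "F = 0"
proof (rule ccontr)
  assume "F \<noteq> 0"
  define n where "n = subdegree F"
  define G where "G = fps_shift n F"
  have Gf: "(\<lambda>x. if x = 0 then fps_nth F n else f x / x ^ n) has_fps_expansion G"
    unfolding G_def n_def by (rule has_fps_expansion_shift[OF F]) auto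
  let ?g = "\<lambda>x. if x = 0 then fps_nth F n else f x / x ^ n"
  have "isCont ?g 0"
    using has_fps_expansion_imp_continuous[OF Gf, of UNIV] by simp
  then have "(?g \<longlongrightarrow> fps_nth F n) (at 0)"
    by (simp add: isCont_def)
  moreover have "fps_nth F n \<noteq> 0"
    unfolding n_def using \<open>F \<noteq> 0\<close> by simp
  ultimately have "\<forall>\<^sub>F x in at 0. ?g x \<noteq> 0"
    by (rule tendsto_imp_eventually_ne)
  then have "\<forall>\<^sub>F x in at 0. f x \<noteq> 0"
    using eventually_neq_at_within[of 0 0 UNIV] by eventually_elim auto
  then show False
    using freq by (simp add: frequently_def)
qed

text \<open>Identity theorem on a ray: let \<open>a\<close> be the infimum of the points from which
  \<open>f\<close> vanishes. If \<open>a > b\<close>, zeros accumulate at \<open>a\<close> from the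
  right, so the expansion at \<open>a\<close> is zero and \<open>f\<close> vanishes somewhat to the
  left of \<open>a\<close> as well.\<close>

lemma real_analytic_on_eq_0:
  assumes f: "real_analytic_on f {b<..}" and zero: "\<forall>\<^sub>F x in at_top. f x = 0" and "x > b"
  shows "f x = 0"
proof -
  define S where "S = {a. b \<le> a \<and> (\<forall>x>a. f x = 0)}"
  obtain a0 where "\<forall>x>a0. f x = 0"
    using zero by (auto simp: eventually_at_top_dense)
  then have ne: "max b a0 \<in> S"
    by (auto simp: S_def)
  have bdd: "bdd_below S"
    by (rule bdd_belowI[of _ b]) (auto simp: S_def)
  define a where "a = Inf S"
  have "a \<ge> b"
    unfolding a_def using ne by (intro cInf_greatest) (blast, simp add: S_def)
  have a: "f x = 0" if "x > a" for x
  proof -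
    obtain y where "y \<in> S" "y < x"
      using \<open>x > a\<close> cInf_less_iff[OF _ bdd] ne unfolding a_def by blast
    then show ?thesis by (auto simp: S_def)
  qed
  have "a = b"
  proof (rule ccontr)
    assume "a \<noteq> b"
    with \<open>a \<ge> b\<close> have "a > b" by simp
    then obtain F where F: "(\<lambda>h. f (a + h)) has_fps_expansion F"
      using f by (auto simp: real_analytic_on_def)
    have "\<exists>\<^sub>F h in at_right (0::real). f (a + h) = 0"
      by (intro eventually_frequently) (auto simp: eventually_at_filter a)
    then have "\<exists>\<^sub>F h in at 0. f (a + h) = 0"
      using at_le[of "{0<..}" UNIV "0::real"] by (auto simp: frequently_def le_filter_def)
    from has_fps_expansion_eq_0I[OF F this] have "F = 0" .
    with F have "\<forall>\<^sub>F h in nhds 0. 0 = f (a + h)"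
      by (simp add: has_fps_expansion_def)
    then have "\<forall>\<^sub>F h in nhds 0. f (a + h) = 0"
      by eventually_elim simp
    then obtain d where d: "d > 0" "\<And>h. \<bar>h\<bar> < d \<Longrightarrow> f (a + h) = 0"
      by (auto simp: eventually_nhds_metric dist_real_def)
    \<comment> \<open>The maximum with \<open>b\<close> keeps \<open>a'\<close> in \<open>S\<close>,
      and \<open>a > b\<close> still makes it smaller than \<open>a\<close>.\<close>
    define a' where "a' = max b (a - d / 2)"
    have "f x = 0" if "x > a'" for x
    proof (cases "x > a")
      case False
      with that have "\<bar>x - a\<bar> < d" using d(1) by (auto simp: a'_def)
      from d(2)[OF this] show ?thesis by simp
    qed (rule a)
    then have "a' \<in> S" by (simp add: S_def a'_def)
    then have "a \<le> a'" unfolding a_def using bdd by (rule cInf_lower)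
    then show False using \<open>a > b\<close> d(1) by (auto simp: a'_def)
  qed
  then show ?thesis using a \<open>x > b\<close> by blast
qed

section \<open>Real analyticity under linear operations and translations\<close>

lemma real_analytic_onD:
  assumes "real_analytic_on f S" "x \<in> S"
  obtains F where "(\<lambda>h. f (x + h)) has_fps_expansion F"
  using assms by (auto simp only: real_analytic_on_def)

lemma real_analytic_on_subset:
  assumes "real_analytic_on f T" "S \<subseteq> T"
  shows "real_analytic_on f S"
  using assms by (simp add: real_analytic_on_def subset_iff)

lemma real_analytic_on_const: "real_analytic_on (\<lambda>_. c) S"
  unfolding real_analytic_on_def by (intro ballI exI[of _ "fps_const c"]) simp

lemma real_analytic_on_cmult:
  assumes "real_analytic_on f S"
  shows "real_analytic_on (\<lambda>x. c * f x) S"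
  unfolding real_analytic_on_def
proof
  fix x assume "x \<in> S"
  from real_analytic_onD[OF assms this]
  obtain F where "(\<lambda>h. f (x + h)) has_fps_expansion F" .
  from has_fps_expansion_cmult_left[OF this]
  show "\<exists>F. (\<lambda>h. c * f (x + h)) has_fps_expansion F" ..
qed

lemma real_analytic_on_add:
  assumes "real_analytic_on f S" "real_analytic_on g S"
  shows "real_analytic_on (\<lambda>x. f x + g x) S"
  unfolding real_analytic_on_def
proof
  fix x assume x: "x \<in> S"
  from real_analytic_onD[OF assms(1) x]
  obtain F where F: "(\<lambda>h. f (x + h)) has_fps_expansion F" .
  from real_analytic_onD[OF assms(2) x]
  obtain G where G: "(\<lambda>h. g (x + h)) has_fps_expansion G" .
  from has_fps_expansion_add[OF F G]
  show "\<exists>F. (\<lambda>h. f (x + h) + g (x + h)) has_fps_expansion F" ..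
qed

lemma real_analytic_on_diff:
  assumes "real_analytic_on f S" "real_analytic_on g S"
  shows "real_analytic_on (\<lambda>x. f x - g x) S"
  using real_analytic_on_add[OF assms(1) real_analytic_on_cmult[OF assms(2), of "- 1"]] by simp

lemma real_analytic_on_shift:
  "real_analytic_on f S \<Longrightarrow> real_analytic_on (\<lambda>x. f (x - t)) ((\<lambda>x. x + t) ` S)"
proof -
  have "x + t + h - t = x + h" for x h :: real by simp
  then show "real_analytic_on f S \<Longrightarrow> real_analytic_on (\<lambda>x. f (x - t)) ((\<lambda>x. x + t) ` S)"
    by (simp add: real_analytic_on_def)
qed

text \<open>The parameter \<open>b\<close> records how far to the left analyticity reaches; it is
  what decreases during the continuation in \<open>gabor_relation_split\<close>.\<close>

definition analytic_beyond :: "real \<Rightarrow> (real \<Rightarrow> complex) \<Rightarrow> bool" where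
  "analytic_beyond b v \<longleftrightarrow>
     real_analytic_on (\<lambda>x. Re (v x)) {b<..} \<and> real_analytic_on (\<lambda>x. Im (v x)) {b<..}"

lemma analytic_beyond_eq_0:
  assumes "analytic_beyond b v" "\<forall>\<^sub>F x in at_top. v x = 0" "x > b"
  shows "v x = 0"
proof -
  have "\<forall>\<^sub>F x in at_top. Re (v x) = 0" "\<forall>\<^sub>F x in at_top. Im (v x) = 0"
    using assms(2) by (auto elim: eventually_mono)
  then show ?thesis
    using assms(1,3) real_analytic_on_eq_0 by (auto simp: analytic_beyond_def complex_eq_iff)
qed

lemma analytic_beyond_mono: "analytic_beyond b v \<Longrightarrow> b \<le> b' \<Longrightarrow> analytic_beyond b' v"
  unfolding analytic_beyond_def
  using real_analytic_on_subset[of _ "{b<..}" "{b'<..}"] by simp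

lemma image_add_greaterThan_real: "(\<lambda>x. x + t) ` {b<..} = {b + t<..}" for b t :: real
proof (intro equalityI subsetI)
  fix x assume "x \<in> {b + t<..}"
  then show "x \<in> (\<lambda>x. x + t) ` {b<..}"
    by (intro image_eqI[of _ _ "x - t"]) auto
qed auto

lemma analytic_beyond_shift: "analytic_beyond b v \<Longrightarrow> analytic_beyond (b + t) (\<lambda>x. v (x - t))"
  using image_add_greaterThan_real[of t b]
    real_analytic_on_shift[of "\<lambda>x. Re (v x)" "{b<..}" t]
    real_analytic_on_shift[of "\<lambda>x. Im (v x)" "{b<..}" t]
  by (simp add: analytic_beyond_def)

lemma analytic_beyond_cmult:
  assumes "analytic_beyond b v"
  shows "analytic_beyond b (\<lambda>x. c * v x)"
  using assms unfolding analytic_beyond_def times_complex.sel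
  by (intro conjI real_analytic_on_add real_analytic_on_diff real_analytic_on_cmult) simp_all

lemma analytic_beyond_sum:
  assumes "\<And>i. i \<in> I \<Longrightarrow> analytic_beyond b (v i)"
  shows "analytic_beyond b (\<lambda>x. \<Sum>i\<in>I. v i x)"
  using assms
proof (induction I rule: infinite_finite_induct)
  case (insert i I)
  then have "analytic_beyond b (v i)" "analytic_beyond b (\<lambda>x. \<Sum>i\<in>I. v i x)" by simp_all
  with insert.hyps show ?case
    by (simp add: analytic_beyond_def real_analytic_on_add)
qed (simp_all add: analytic_beyond_def real_analytic_on_const)

section \<open>Entire functions with singular bounds on the imaginary axis\<close>

text \<open>A pole would force \<open>\<bar>F (z + t)\<bar>\<close> to grow at least like \<open>1 / \<bar>t\<bar>\<close>.\<close>
lemma not_pole_if_inverse_sqrt_bound: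
  assumes F: "isolated_singularity_at F z"
    and bound: "\<forall>\<^sub>F w in at z. Re w \<noteq> 0 \<longrightarrow> cmod (F w) \<le> C / sqrt \<bar>Re w\<bar>"
  shows "\<not> is_pole F z"
proof
  assume pole: "is_pole F z"
  have "\<forall>\<^sub>F w in at z. F w \<noteq> 0"
    using non_zero_neighbour_pole[OF pole] .
  then obtain r1 where r1: "r1 > 0" "\<And>w. w \<in> ball z r1 - {z} \<Longrightarrow> F w \<noteq> 0"
    by (auto simp: eventually_at dist_commute)
  obtain r2 where r2: "r2 > 0" "F analytic_on ball z r2 - {z}"
    using F by (auto simp: isolated_singularity_at_def)
  define r where "r = min r1 r2"
  \<comment> \<open>At a pole this extended reciprocal is holomorphic with value 0; boundedness of
    its difference quotient is the lower bound on the growth of \<open>F\<close>.\<close>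
  define G where "G = (\<lambda>x. if x = z then 0 else inverse (F x))"
  have "r > 0" using r1 r2 by (simp add: r_def)
  have "G holomorphic_on ball z r"
    unfolding G_def
  proof (rule is_pole_inverse_holomorphic[OF _ _ pole])
    have "F holomorphic_on ball z r2 - {z}"
      using r2(2) analytic_imp_holomorphic by blast
    then show "F holomorphic_on ball z r - {z}"
      by (rule holomorphic_on_subset) (auto simp: r_def)
  qed (use r1 in \<open>auto simp: r_def\<close>)
  then have "G field_differentiable at z"
    using \<open>r > 0\<close> by (simp add: holomorphic_on_imp_differentiable_at)
  then obtain D where "(G has_field_derivative D) (at z)"
    by (auto simp: field_differentiable_def)
  then have D: "((\<lambda>h. G (z + h) / h) \<longlongrightarrow> D) (at 0)"
    by (simp add: DERIV_def G_def)
  \<comment> \<open>Approaching \<open>z\<close> horizontally and away from the imaginary axis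
    ensures \<open>\<bar>Re w\<bar> \<ge> t\<close> for \<open>w = z + of_real (d * t)\<close>,
    wherever \<open>z\<close> lies.\<close>
  define d :: real where "d = (if Re z \<ge> 0 then 1 else -1)"
  have dlim: "filterlim (\<lambda>t. of_real (d * t) :: complex) (at 0) (at_right (0::real))"
    unfolding filterlim_at
  proof
    show "\<forall>\<^sub>F t in at_right 0. of_real (d * t) \<in> UNIV \<and> of_real (d * t) \<noteq> (0::complex)"
      by (auto simp: eventually_at_filter d_def)
    have "((\<lambda>t. of_real (d * t) :: complex) \<longlongrightarrow> of_real (d * 0)) (at_right 0)"
      by (intro tendsto_intros)
    then show "((\<lambda>t. of_real (d * t) :: complex) \<longlongrightarrow> 0) (at_right 0)" by simp
  qed
  have "((\<lambda>t. cmod (G (z + of_real (d * t)) / of_real (d * t))) \<longlongrightarrow> cmod D) (at_right 0)"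
    by (intro tendsto_norm filterlim_compose[OF D dlim])
  then have "\<forall>\<^sub>F t in at_right 0. cmod (G (z + of_real (d * t)) / of_real (d * t)) < cmod D + 1"
    by (rule order_tendstoD) simp
  moreover have zlim: "filterlim (\<lambda>t. z + of_real (d * t)) (at z) (at_right (0::real))"
    using dlim by (auto simp: filterlim_at tendsto_add_const_iff[of z _ 0, simplified])
  have "\<forall>\<^sub>F t in at_right 0. Re (z + of_real (d * t)) \<noteq> 0 \<longrightarrow>
      cmod (F (z + of_real (d * t))) \<le> C / sqrt \<bar>Re (z + of_real (d * t))\<bar>"
    by (rule eventually_compose_filterlim[OF bound zlim])
  moreover have "\<forall>\<^sub>F t in at_right 0. F (z + of_real (d * t)) \<noteq> 0"
    by (rule eventually_compose_filterlim[OF \<open>\<forall>\<^sub>F w in at z. F w \<noteq> 0\<close> zlim])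
  \<comment> \<open>This supplies the smallness of
    \<open>(cmod D + 1) * \<bar>C\<bar> * sqrt t\<close> that contradicts the growth at a
    pole.\<close>
  moreover have "filterlim (\<lambda>t. 1 / sqrt t) at_top (at_right (0::real))"
    by real_asymp
  then have "\<forall>\<^sub>F t in at_right 0. \<bar>C\<bar> * (cmod D + 1) < 1 / sqrt t"
    by (simp add: filterlim_at_top_dense)
  moreover have "\<forall>\<^sub>F t in at_right (0::real). t > 0" "\<forall>\<^sub>F t in at_right (0::real). t < 1"
    by (auto simp: eventually_at_right_field intro: exI[of _ 1])
  moreover have "\<forall>\<^sub>F t in at_right (0::real). t < \<bar>Re z\<bar> \<or> Re z \<ge> 0"
    by (cases "Re z \<ge> 0") (auto simp: eventually_at_right_field intro: exI[of _ "\<bar>Re z\<bar>"])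
  ultimately have "\<forall>\<^sub>F t in at_right (0::real). False"
  proof eventually_elim
    case (elim t)
    let ?w = "z + of_real (d * t)"
    have t: "t > 0" "\<bar>Re ?w\<bar> \<ge> t"
      using elim by (auto simp: d_def)
    have "cmod (F ?w) \<le> C / sqrt \<bar>Re ?w\<bar>"
      using elim t by auto
    also have "\<dots> \<le> \<bar>C\<bar> / sqrt t"
      using t by (intro frac_le) auto
    finally have Fle: "cmod (F ?w) * sqrt t \<le> \<bar>C\<bar>"
      using t by (simp add: field_simps)
    have "?w \<noteq> z" using t by (auto simp: d_def)
    then have "cmod (G ?w / of_real (d * t)) = 1 / (cmod (F ?w) * t)"
      using t by (simp add: G_def norm_divide norm_inverse norm_mult d_def divide_simps)
    then have "1 / (cmod (F ?w) * t) < cmod D + 1"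
      using elim by simp
    then have "1 < (cmod D + 1) * (cmod (F ?w) * t)"
      using elim t by (simp add: divide_less_eq)
    also have "\<dots> = (cmod D + 1) * (cmod (F ?w) * sqrt t) * sqrt t"
      using t by simp
    also have "\<dots> \<le> (cmod D + 1) * \<bar>C\<bar> * sqrt t"
      using Fle t by (intro mult_right_mono mult_left_mono) auto
    also have "\<dots> < 1"
      using elim t by (simp add: field_simps)
    finally show False .
  qed
  then show False by simp
qed

text \<open>On the circle \<open>\<bar>w\<bar> = R\<close> one has \<open>\<bar>w\<^sup>2 + R\<^sup>2\<bar> = 2 R \<bar>Re w\<bar>\<close>, which absorbs the singularity of the bound
  on the imaginary axis.\<close>
lemma entire_inverse_sqrt_bound_eq_0:
  assumes F: "F holomorphic_on UNIV"
    and bound: "\<And>w. Re w \<noteq> 0 \<Longrightarrow> cmod (F w) \<le> C / sqrt \<bar>Re w\<bar>"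
  shows "F s = 0"
proof -
  have "C \<ge> 0"
    using order_trans[OF norm_ge_zero bound[of 1]] by simp
  have main: "cmod (F s) \<le> 2 * C * R * sqrt R / (R\<^sup>2 - (cmod s)\<^sup>2)" if R: "R > cmod s" for R
  proof -
    have R0: "R > 0" using R norm_ge_zero[of s] by linarith
    have "cmod (F s * (s\<^sup>2 + of_real R^2)) \<le> 2 * C * R * sqrt R"
    proof (rule maximum_modulus_frontier[where S = "cball 0 R" and f = "\<lambda>w::complex. F w * (w\<^sup>2 + of_real R^2)"])
      have "(\<lambda>w. F w * (w\<^sup>2 + of_real R^2)) holomorphic_on UNIV"
        by (intro holomorphic_intros F)
      then show "(\<lambda>w. F w * (w\<^sup>2 + of_real R^2)) holomorphic_on interior (cball 0 R)"
        "continuous_on (closure (cball 0 R)) (\<lambda>w. F w * (w\<^sup>2 + of_real R^2))"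
        by (auto intro: holomorphic_on_subset holomorphic_on_imp_continuous_on)
      fix w :: complex assume "w \<in> frontier (cball 0 R)"
      then have w: "cmod w = R" using R0 by simp
      have "w\<^sup>2 + of_real R^2 = w * (w + cnj w)"
        using complex_norm_square[of w] w by (simp add: power2_eq_square ring_distribs)
      then have eq: "cmod (w\<^sup>2 + of_real R^2) = 2 * R * \<bar>Re w\<bar>"
        using w by (simp add: complex_add_cnj norm_mult)
      show "cmod (F w * (w\<^sup>2 + of_real R^2)) \<le> 2 * C * R * sqrt R"
      \<comment> \<open>At the two points of the circle where the hypothesis gives no bound, the
        factor \<open>w^2 + R^2\<close> vanishes.\<close>
      proof (cases "Re w = 0")
        case True
        then show ?thesis using eq \<open>C \<ge> 0\<close> R0 by (simp add: norm_mult)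
      next
        case False
        have "cmod (F w * (w\<^sup>2 + of_real R^2)) \<le> C / sqrt \<bar>Re w\<bar> * (2 * R * \<bar>Re w\<bar>)"
          unfolding norm_mult eq using R0 by (intro mult_right_mono bound False) auto
        also have "\<dots> = 2 * C * R * (\<bar>Re w\<bar> / sqrt \<bar>Re w\<bar>)"
          by simp
        also have "\<bar>Re w\<bar> / sqrt \<bar>Re w\<bar> = sqrt \<bar>Re w\<bar>"
          by (simp add: real_div_sqrt)
        also have "2 * C * R * sqrt \<bar>Re w\<bar> \<le> 2 * C * R * sqrt R"
          using abs_Re_le_cmod[of w] w R0 \<open>C \<ge> 0\<close> by (intro mult_left_mono) auto
        finally show ?thesis .
      qed
    qed (use R in auto)
    moreover have "R\<^sup>2 - (cmod s)\<^sup>2 \<le> cmod (s\<^sup>2 + of_real R^2)"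
      using norm_triangle_ineq2[of "of_real R ^ 2" "- s\<^sup>2"] R0
      by (simp add: norm_power add.commute)
    then have "cmod (F s) * (R\<^sup>2 - (cmod s)\<^sup>2) \<le> cmod (F s * (s\<^sup>2 + of_real R^2))"
      unfolding norm_mult by (rule mult_left_mono) simp
    moreover have "R\<^sup>2 - (cmod s)\<^sup>2 > 0"
      using R by (simp add: power_strict_mono)
    ultimately show ?thesis
      by (simp add: pos_le_divide_eq)
  qed
  \<comment> \<open>The numerator grows like the power 3/2 of \<open>R\<close>, the denominator like
    its square.\<close>
  have "((\<lambda>R. 2 * C * R * sqrt R / (R\<^sup>2 - (cmod s)\<^sup>2)) \<longlongrightarrow> 0) at_top"
    by real_asymp
  moreover have "\<forall>\<^sub>F R in at_top. cmod (F s) \<le> 2 * C * R * sqrt R / (R\<^sup>2 - (cmod s)\<^sup>2)"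
    using eventually_gt_at_top[of "cmod s"] by eventually_elim (rule main)
  ultimately have "cmod (F s) \<le> 0"
    by (intro tendsto_le[OF _ _ tendsto_const]) auto
  then show ?thesis by simp
qed

text \<open>The quotient \<open>Q / P\<close> is meromorphic and the bound excludes poles, so it
  extends to an entire function to which \<open>entire_inverse_sqrt_bound_eq_0\<close>
  applies.\<close>

lemma entire_dominated_eq_0:
  assumes P: "P holomorphic_on UNIV" and Q: "Q holomorphic_on UNIV" and ne: "P z0 \<noteq> 0"
    and bound: "\<And>w. Re w \<noteq> 0 \<Longrightarrow> cmod (Q w) \<le> cmod (P w) * (C / sqrt \<bar>Re w\<bar>)"
  shows "Q s = 0"
proof -
  define F0 where "F0 = (\<lambda>w. Q w / P w)"
  have "P analytic_on UNIV" "Q analytic_on UNIV"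
    using P Q by (simp_all add: analytic_on_open)
  then have mero: "F0 meromorphic_on UNIV"
    unfolding F0_def by (intro meromorphic_intros analytic_on_imp_meromorphic_on)
  have Pne: "\<forall>\<^sub>F w in at z. P w \<noteq> 0" for z
    using non_zero_neighbour_alt[OF P open_UNIV connected_UNIV UNIV_I UNIV_I ne] by simp
  have sing: "isolated_singularity_at F0 z" for z
    using mero by (rule meromorphic_on_isolated_singularity[OF meromorphic_on_subset]) simp
  have F0_bound: "\<forall>\<^sub>F w in at z. Re w \<noteq> 0 \<longrightarrow> cmod (F0 w) \<le> C / sqrt \<bar>Re w\<bar>" for z
    using Pne[of z]
  proof eventually_elim
    case (elim w)
    then show ?case
      using bound[of w] by (simp add: F0_def norm_divide divide_le_eq mult.commute)
  qed
  have nopole: "\<not> is_pole F0 z" for z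
    using not_pole_if_inverse_sqrt_bound[OF sing F0_bound] .
  define F where "F = remove_sings F0"
  have F_eq: "\<forall>\<^sub>F w in at z. F w = F0 w" for z
    unfolding F_def by (rule eventually_remove_sings_eq_at[OF sing])
  have "F analytic_on {z}" for z
  proof (rule nicely_meromorphic_on_imp_analytic_at)
    show "F nicely_meromorphic_on UNIV"
      unfolding F_def by (rule remove_sings_nicely_meromorphic[OF mero])
    show "\<not> is_pole F z"
      using nopole[of z] is_pole_cong[OF F_eq[of z] refl] by simp
  qed simp
  then have hol: "F holomorphic_on UNIV"
    by (metis analytic_imp_holomorphic analytic_on_analytic_at)
  then have cont: "F \<midarrow>z\<rightarrow> F z" for z
    using holomorphic_on_imp_continuous_on[OF hol] by (simp add: continuous_on_eq_continuous_at isCont_def)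
  \<comment> \<open>At zeros of \<open>P\<close> the bound for the quotient is not directly
    available; it is obtained as a limit from nearby points.\<close>
  have "cmod (F z) \<le> C / sqrt \<bar>Re z\<bar>" if "Re z \<noteq> 0" for z
  proof (rule tendsto_le[OF trivial_limit_at])
    show "((\<lambda>w. cmod (F w)) \<longlongrightarrow> cmod (F z)) (at z)"
      by (intro tendsto_norm cont)
    show "((\<lambda>w. C / sqrt \<bar>Re w\<bar>) \<longlongrightarrow> C / sqrt \<bar>Re z\<bar>) (at z)"
      using that by (intro tendsto_intros) auto
    have "\<forall>\<^sub>F w in at z. Re w \<noteq> 0"
      using that by (intro tendsto_imp_eventually_ne[of Re "Re z"] tendsto_intros) auto
    with F_eq[of z] F0_bound[of z] show "\<forall>\<^sub>F w in at z. cmod (F w) \<le> C / sqrt \<bar>Re w\<bar>"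
      by eventually_elim simp
  qed
  from entire_inverse_sqrt_bound_eq_0[OF hol this] have F0: "F z = 0" for z .
  \<comment> \<open>Vanishing of the quotient gives \<open>Q = 0\<close> away from the zeros of
    \<open>P\<close>; continuity of \<open>Q\<close> covers \<open>s\<close> itself.\<close>
  have "\<forall>\<^sub>F w in at s. Q w = 0"
    using F_eq[of s] Pne[of s] by eventually_elim (simp add: F0 F0_def)
  then have "(Q \<longlongrightarrow> 0) (at s)"
    by (rule tendsto_eventually)
  moreover have "(Q \<longlongrightarrow> Q s) (at s)"
    using holomorphic_on_imp_continuous_on[OF Q] by (simp add: continuous_on_eq_continuous_at isCont_def)
  ultimately show ?thesis
    using tendsto_unique[OF trivial_limit_at] by metis
qed

section \<open>Fourier and Laplace transforms\<close>

lemma real_distribution_density: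
  fixes p :: "real \<Rightarrow> real"
  assumes "integrable lborel p" "\<And>x. p x \<ge> 0" "(\<integral>x. p x \<partial>lborel) = 1"
  shows "real_distribution (density lborel p)"
proof -
  have "p \<in> borel_measurable borel" using assms(1) by simp
  moreover have "(\<integral>\<^sup>+ x. p x \<partial>lborel) = 1"
    using nn_integral_eq_integral[OF assms(1)] assms by simp
  ultimately show ?thesis
    by (auto simp: real_distribution_def real_distribution_axioms_def emeasure_density intro!: prob_spaceI)
qed

text \<open>The positive and negative parts have equal transforms, and \<open>t = 0\<close> shows
  that they have equal mass \<open>c\<close>. If \<open>c > 0\<close>, division by \<open>c\<close>
  gives two probability densities with the same characteristic function, and Levy's uniqueness
  theorem applies.\<close>

lemma fourier_eq_0_real:
  fixes h :: "real \<Rightarrow> real"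
  assumes h: "integrable lborel h" and zero: "\<And>t. (\<integral>x. of_real (h x) * iexp (t * x) \<partial>lborel) = 0"
  shows "AE x in lborel. h x = 0"
proof -
  define p where "p = (\<lambda>x. max 0 (h x))"
  define n where "n = (\<lambda>x. max 0 (- h x))"
  have h_eq: "h x = p x - n x" for x by (simp add: p_def n_def)
  have int: "integrable lborel p" "integrable lborel n"
    unfolding p_def n_def using h by auto
  have nonneg: "p x \<ge> 0" "n x \<ge> 0" for x by (simp_all add: p_def n_def)
  have int_exp: "integrable lborel (\<lambda>x. of_real (f x) * iexp (t * x))" if "integrable lborel f" for f t
    using that by (intro Bochner_Integration.integrable_bound[OF that]) (auto simp: norm_mult)
  have eq: "(\<integral>x. of_real (p x) * iexp (t * x) \<partial>lborel) = (\<integral>x. of_real (n x) * iexp (t * x) \<partial>lborel)" for t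
    using zero[of t] Bochner_Integration.integral_diff[OF int_exp[OF int(1), of t] int_exp[OF int(2), of t]]
    by (simp add: h_eq ring_distribs)
  define c where "c = (\<integral>x. p x \<partial>lborel)"
  have c: "(\<integral>x. n x \<partial>lborel) = c"
    using eq[of 0] by (simp add: c_def)
  have "c \<ge> 0" unfolding c_def using nonneg by simp
  show ?thesis
  proof (cases "c = 0")
    case True
    then have "AE x in lborel. p x = 0" "AE x in lborel. n x = 0"
      using integral_nonneg_eq_0_iff_AE[OF int(1)] integral_nonneg_eq_0_iff_AE[OF int(2)] c nonneg
      by (auto simp: c_def)
    then show ?thesis by eventually_elim (simp add: h_eq)
  next
    case False
    with \<open>c \<ge> 0\<close> have "c > 0" by simp
    have "density lborel (\<lambda>x. ennreal (p x / c)) = density lborel (\<lambda>x. ennreal (n x / c))"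
    proof (rule Levy_uniqueness)
      show "real_distribution (density lborel (\<lambda>x. ennreal (p x / c)))"
        "real_distribution (density lborel (\<lambda>x. ennreal (n x / c)))"
        using int nonneg \<open>c > 0\<close> c by (auto intro!: real_distribution_density simp: c_def)
      have char: "char (density lborel (\<lambda>x. ennreal (f x / c))) t = (\<integral>x. of_real (f x) * iexp (t * x) \<partial>lborel) / c"
        if "integrable lborel f" "\<And>x. f x \<ge> 0" for f t
      proof -
        have "char (density lborel (\<lambda>x. ennreal (f x / c))) t = (\<integral>x. (f x / c) *\<^sub>R iexp (t * x) \<partial>lborel)"
          unfolding char_def using that \<open>c > 0\<close> by (subst integral_density) auto
        also have "\<dots> = (\<integral>x. of_real (f x) * iexp (t * x) / c \<partial>lborel)"
          by (simp add: scaleR_conv_of_real)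
        finally show ?thesis by simp
      qed
      show "char (density lborel (\<lambda>x. ennreal (p x / c))) = char (density lborel (\<lambda>x. ennreal (n x / c)))"
        using char[OF int(1)] char[OF int(2)] nonneg eq by (auto simp: fun_eq_iff)
    qed
    then have "AE x in lborel. ennreal (p x / c) = ennreal (n x / c)"
      using int by (intro sigma_finite_measure.density_unique[OF lborel.sigma_finite_measure_axioms]) auto
    then show ?thesis
      by eventually_elim (use \<open>c > 0\<close> nonneg in \<open>simp add: h_eq\<close>)
  qed
qed

text \<open>Conjugating \<open>k\<close> conjugates its transform and reflects \<open>t\<close>, so
  the real part of \<open>k\<close> has zero transform as well. The imaginary part of
  \<open>h\<close> is the real part of \<open>- \<i> * h\<close>.\<close>

lemma fourier_eq_0:
  fixes h :: "real \<Rightarrow> complex"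
  assumes h: "integrable lborel h" and zero: "\<And>t. (\<integral>x. h x * iexp (t * x) \<partial>lborel) = 0"
  shows "AE x in lborel. h x = 0"
proof -
  have Re0: "AE x in lborel. Re (k x) = 0"
    if k: "integrable lborel k" and k0: "\<And>t. (\<integral>x. k x * iexp (t * x) \<partial>lborel) = 0"
    for k :: "real \<Rightarrow> complex"
  proof (rule fourier_eq_0_real)
    show "integrable lborel (\<lambda>x. Re (k x))" using k by simp
    fix t
    have int: "integrable lborel (\<lambda>x. k x * iexp (t * x))" for t
      using k by (intro Bochner_Integration.integrable_bound[OF k]) (auto simp: norm_mult)
    have int': "integrable lborel (\<lambda>x. cnj (k x) * iexp (t * x))"
      using integrable_cnj[OF int[of "- t"]] by (simp add: exp_cnj)
    have "(\<integral>x. cnj (k x) * iexp (t * x) \<partial>lborel) = (\<integral>x. cnj (k x * iexp (- t * x)) \<partial>lborel)"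
      by (simp add: exp_cnj)
    also have "\<dots> = cnj (\<integral>x. k x * iexp (- t * x) \<partial>lborel)"
      by (rule Bochner_Integration.integral_cnj)
    finally have cnj0: "(\<integral>x. cnj (k x) * iexp (t * x) \<partial>lborel) = 0"
      using k0[of "- t"] by simp
    have "(\<integral>x. of_real (Re (k x)) * iexp (t * x) \<partial>lborel)
        = (\<integral>x. (k x * iexp (t * x) + cnj (k x) * iexp (t * x)) / 2 \<partial>lborel)"
      by (intro Bochner_Integration.integral_cong refl)
         (simp add: complex_add_cnj flip: distrib_right)
    then show "(\<integral>x. of_real (Re (k x)) * iexp (t * x) \<partial>lborel) = 0"
      using int int' k0 cnj0 by simp
  qed
  have "(\<integral>x. - \<i> * h x * iexp (t * x) \<partial>lborel) = 0" for t
    using integral_mult_right_zero[of lborel "- \<i>" "\<lambda>x. h x * iexp (t * x)"] zero[of t]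
    by (simp only: mult.assoc mult_zero_right)
  with Re0[of "\<lambda>x. - \<i> * h x"] h have "AE x in lborel. Im (h x) = 0"
    by simp
  with Re0[OF h zero] show ?thesis
    by eventually_elim (simp add: complex_eq_iff)
qed

section \<open>Two-sided Laplace transform\<close>

text \<open>A nonintegrable integrand gives the value 0, which explains the integrability assumption
  of \<open>laplace_sum_shift\<close>, where the integral is split into summands.\<close>

definition laplace :: "(real \<Rightarrow> complex) \<Rightarrow> complex \<Rightarrow> complex" where
  "laplace f s = (\<integral>x. f x * exp (- (s * of_real x)) \<partial>lborel)"

lemma laplace_shift: "laplace (\<lambda>x. f (x - a)) s = exp (- (s * of_real a)) * laplace f s"
proof -
  have "laplace (\<lambda>x. f (x - a)) s = (\<integral>x. f x * exp (- (s * of_real (a + x))) \<partial>lborel)"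
    unfolding laplace_def by (subst lborel_integral_real_affine[where c = 1 and t = a]) auto
  also have "\<dots> = (\<integral>x. exp (- (s * of_real a)) * (f x * exp (- (s * of_real x))) \<partial>lborel)"
    by (intro Bochner_Integration.integral_cong refl) (simp add: ring_distribs exp_diff exp_minus field_simps)
  finally show ?thesis by (simp add: laplace_def)
qed

text \<open>Expand the exponential and integrate termwise. On the support
  \<open>\<bar>x\<bar> \<le> A\<close>, so the terms are dominated by
  \<open>cmod (h x) * ((A * cmod s) ^ n / fact n)\<close>, which is summable for every
  \<open>s\<close>.\<close>

lemma laplace_entire:
  assumes h: "integrable lborel h" and supp: "\<And>x. \<bar>x\<bar> > A \<Longrightarrow> h x = 0" and "A \<ge> 0"
  shows "laplace h holomorphic_on UNIV"
proof -
  define a where "a = (\<lambda>n. \<integral>x. h x * of_real ((- x) ^ n / fact n) \<partial>lborel)"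
  have [measurable]: "h \<in> borel_measurable borel" using h by simp
  have bound: "cmod (h x * of_real ((- x) ^ n / fact n)) \<le> cmod (h x) * (A ^ n / fact n)" for n x
  proof (cases "\<bar>x\<bar> > A")
    case False
    then show ?thesis
      using \<open>A \<ge> 0\<close> by (auto simp: norm_mult norm_divide norm_power intro!: mult_left_mono divide_right_mono power_mono)
  qed (simp add: supp)
  have int: "integrable lborel (\<lambda>x. h x * of_real ((- x) ^ n / fact n))" for n
    by (rule Bochner_Integration.integrable_bound[of _ "\<lambda>x. cmod (h x) * (A ^ n / fact n)"])
       (use h bound \<open>A \<ge> 0\<close> in auto)
  have "(\<lambda>n. a n * s ^ n) sums laplace h s" for s
  proof -
    define F where "F = (\<lambda>n x. h x * of_real ((- x) ^ n / fact n) * s ^ n)"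
    have F_sums: "(\<lambda>n. F n x) sums (h x * exp (- (s * of_real x)))" for x
    proof -
      have "(\<lambda>n. h x * ((- (s * of_real x)) ^ n /\<^sub>R fact n)) sums (h x * exp (- (s * of_real x)))"
        by (intro sums_mult exp_converges)
      moreover have "h x * ((- (s * of_real x)) ^ n /\<^sub>R fact n) = F n x" for n
        by (simp add: F_def scaleR_conv_of_real power_mult_distrib field_simps flip: mult_minus_right of_real_minus)
      ultimately show ?thesis by simp
    qed
    have intF: "integrable lborel (F n)" for n
      unfolding F_def by (intro integrable_mult_left int)
    have normF: "cmod (F n x) \<le> cmod (h x) * ((A * cmod s) ^ n / fact n)" for n x
    proof -
      have "cmod (F n x) = cmod (h x * of_real ((- x) ^ n / fact n)) * cmod s ^ n"
        unfolding F_def by (simp only: norm_mult norm_power)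
      also have "\<dots> \<le> cmod (h x) * (A ^ n / fact n) * cmod s ^ n"
        by (intro mult_right_mono bound) simp
      finally show ?thesis by (simp add: power_mult_distrib)
    qed
    have sumA: "summable (\<lambda>n. C * ((A * cmod s) ^ n / fact n))" for C
      using summable_exp_generic[of "A * cmod s"] by (intro summable_mult) (simp add: field_simps)
    have "(\<lambda>n. integral\<^sup>L lborel (F n)) sums (\<integral>x. (\<Sum>n. F n x) \<partial>lborel)"
    proof (rule sums_integral[OF intF])
      show "AE x in lborel. summable (\<lambda>n. cmod (F n x))"
        by (intro AE_I2 summable_comparison_test'[OF sumA, where N = 0]) (use normF in auto)
      show "summable (\<lambda>n. \<integral>x. cmod (F n x) \<partial>lborel)"
      proof (rule summable_comparison_test'[OF sumA, where N = 0])
        fix n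
        have "(\<integral>x. cmod (F n x) \<partial>lborel) \<le> (\<integral>x. cmod (h x) * ((A * cmod s) ^ n / fact n) \<partial>lborel)"
          using h intF normF by (intro integral_mono) auto
        then show "norm (\<integral>x. cmod (F n x) \<partial>lborel) \<le> (\<integral>x. cmod (h x) \<partial>lborel) * ((A * cmod s) ^ n / fact n)"
          by simp
      qed
    qed
    moreover have "integral\<^sup>L lborel (F n) = a n * s ^ n" for n
      unfolding F_def a_def by simp
    moreover have "(\<Sum>n. F n x) = h x * exp (- (s * of_real x))" for x
      using F_sums by (rule sums_unique[symmetric])
    ultimately show ?thesis by (simp add: laplace_def)
  qed
  then have "laplace h holomorphic_on ball 0 r" for r
    by (intro power_series_holomorphic[where a = a]) simp
  then have "laplace h holomorphic_on (\<Union>r. ball 0 r)"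
    by (intro holomorphic_on_UN_open) auto
  moreover have "(\<Union>r. ball 0 r) = (UNIV :: complex set)"
    by (auto intro: gt_ex)
  ultimately show ?thesis by simp
qed

section \<open>Almost-everywhere statements on the line\<close>

lemma AE_lborel_shift:
  fixes t :: real
  assumes "AE x in lborel. P x"
  shows "AE x in lborel. P (x - t)"
proof -
  obtain N where N: "{x. \<not> P x} \<subseteq> N" "N \<in> null_sets lborel"
    using assms by (auto simp: eventually_ae_filter)
  have "AE x in lborel. - t + 1 * x \<notin> N"
    using N(2) by (intro AE_borel_affine AE_not_in) auto
  then show ?thesis
    by eventually_elim (use N(1) in auto)
qed

lemma AE_lborel_shift_iff:
  fixes t :: real
  shows "(AE x in lborel. P (x - t)) \<longleftrightarrow> (AE x in lborel. P x)"
proof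
  assume "AE x in lborel. P (x - t)"
  from AE_lborel_shift[OF this, of "- t"] show "AE x in lborel. P x" by simp
qed (rule AE_lborel_shift)

text \<open>The set beyond \<open>a\<close> where \<open>f\<close> differs from \<open>c\<close> is
  open, and a nonempty open set is not null.\<close>

lemma continuous_AE_eq_0:
  fixes f :: "real \<Rightarrow> 'b::t1_space"
  assumes "AE x in lborel. x > a \<longrightarrow> f x = c" "\<And>x. x > a \<Longrightarrow> isCont f x" "x > a"
  shows "f x = c"
proof (rule ccontr)
  assume "f x \<noteq> c"
  have "continuous_on {a<..} f"
    using assms(2) by (simp add: continuous_at_imp_continuous_on)
  then have "open ({a<..} \<inter> f -` (- {c}))"
    by (intro continuous_open_preimage) auto
  moreover have "x \<in> {a<..} \<inter> f -` (- {c})"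
    using assms(3) \<open>f x \<noteq> c\<close> by simp
  ultimately have "{a<..} \<inter> f -` (- {c}) \<notin> null_sets lborel"
    using open_not_negligible by (metis empty_iff negligible_iff_null_sets null_sets_completionI)
  moreover have "{a<..} \<inter> f -` (- {c}) \<in> sets lborel"
    using \<open>open _\<close> by simp
  moreover have "AE x in lborel. x \<notin> {a<..} \<inter> f -` (- {c})"
    using assms(1) by eventually_elim auto
  ultimately show False
    by (simp add: AE_iff_null_sets)
qed

lemma has_bochner_integral_exp_abs:
  fixes u :: real
  assumes "u > 0"
  shows "has_bochner_integral lborel (\<lambda>x. exp (- (u * \<bar>x\<bar>))) (2 / u)"
proof -
  have "has_bochner_integral lborel (\<lambda>x. exp (- (u * x)) * indicator {0..} (u * x)) (1 / u)"
    using lborel_has_bochner_integral_real_affine_iff[of u "\<lambda>x. exp (- x) * indicator {0..} x" 1 0]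
      has_bochner_integral_I0i_power_exp_m'[of 0] assms by (simp add: divide_inverse)
  then have "has_bochner_integral lborel (\<lambda>x. indicator {0..} x *\<^sub>R exp (- (u * \<bar>x\<bar>))) (1 / u)"
    by (rule has_bochner_integral_cong[THEN iffD1, rotated -1])
       (use assms in \<open>auto simp: indicator_def zero_le_mult_iff\<close>)
  from has_bochner_integral_even_function[OF this] show ?thesis by simp
qed

text \<open>The support condition makes \<open>\<bar>exp (- s x)\<bar> = exp (- \<bar>Re s\<bar> \<bar>x\<bar>)\<close>, and the bound is AM-GM with
  weight \<open>sqrt \<bar>Re s\<bar>\<close>.\<close>
lemma
  fixes f :: "real \<Rightarrow> complex"
  assumes f [measurable]: "f \<in> borel_measurable borel" and L2: "integrable lborel (\<lambda>x. (cmod (f x))\<^sup>2)"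
    and supp: "\<And>x. f x \<noteq> 0 \<Longrightarrow> Re s * x \<ge> 0" and s: "Re s \<noteq> 0"
  shows laplace_integrable_half_line: "integrable lborel (\<lambda>x. f x * exp (- (s * of_real x)))"
    and cmod_laplace_half_line_le:
      "cmod (laplace f s) \<le> ((\<integral>x. (cmod (f x))\<^sup>2 \<partial>lborel) + 1) / sqrt \<bar>Re s\<bar>"
proof -
  define r where "r = sqrt \<bar>Re s\<bar>"
  have r: "r > 0" "\<bar>Re s\<bar> = r * r" using s by (simp_all add: r_def)
  \<comment> \<open>The exponential integrates to \<open>1 / (r * r)\<close>, so with weight
    \<open>r\<close> both summands contribute on the scale \<open>1 / r\<close>.\<close>
  define B where "B = (\<lambda>x. (cmod (f x))\<^sup>2 / r + r * exp (- (2 * (r * r) * \<bar>x\<bar>)))"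
  have e: "has_bochner_integral lborel (\<lambda>x. exp (- (2 * (r * r) * \<bar>x\<bar>))) (2 / (2 * (r * r)))"
    using r by (intro has_bochner_integral_exp_abs) simp
  then have B: "integrable lborel B"
    unfolding B_def using L2 by (auto dest: integrable.intros)
  have le: "cmod (f x * exp (- (s * of_real x))) \<le> B x" for x
  proof (cases "f x = 0")
    case False
    then have "Re s * x = r * r * \<bar>x\<bar>"
      using supp[of x] r(2) by (metis abs_mult abs_of_nonneg)
    then have "cmod (f x * exp (- (s * of_real x))) = cmod (f x) * exp (- (r * r * \<bar>x\<bar>))"
      by (simp add: norm_mult)
    also have "\<dots> = (cmod (f x) / r) * (r * exp (- (r * r * \<bar>x\<bar>)))"
      using r by simp
    also have "\<dots> \<le> B x"
    proof -
      define p q where "p = cmod (f x)" and "q = exp (- (r * r * \<bar>x\<bar>))"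
      have "2 * (p * q * r) \<le> p\<^sup>2 + (q * r)\<^sup>2"
        using sum_squares_bound[of p "q * r"] by (simp add: mult_ac)
      moreover have "0 \<le> p\<^sup>2 + (q * r)\<^sup>2" by simp
      ultimately have "p * q * r \<le> p\<^sup>2 + (q * r)\<^sup>2" by linarith
      then have "p * q \<le> p\<^sup>2 / r + r * q\<^sup>2"
        using r by (simp add: field_simps power2_eq_square)
      moreover have "q\<^sup>2 = exp (- (2 * (r * r) * \<bar>x\<bar>))"
        by (simp add: q_def power2_eq_square mult_exp_exp)
      ultimately show ?thesis using r by (simp add: B_def p_def q_def)
    qed
    finally show ?thesis .
  qed (use r in \<open>simp add: B_def\<close>)
  show int: "integrable lborel (\<lambda>x. f x * exp (- (s * of_real x)))"
    by (rule Bochner_Integration.integrable_bound[OF B]) (use order_trans[OF le abs_ge_self] in auto)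
  have "cmod (laplace f s) \<le> (\<integral>x. cmod (f x * exp (- (s * of_real x))) \<partial>lborel)"
    unfolding laplace_def by (rule integral_norm_bound)
  also have "\<dots> \<le> (\<integral>x. B x \<partial>lborel)"
    by (rule integral_mono) (use int B le in auto)
  also have "\<dots> = (\<integral>x. (cmod (f x))\<^sup>2 \<partial>lborel) / r + r * (1 / (r * r))"
    unfolding B_def using L2 e
    by (subst Bochner_Integration.integral_add) (auto dest: integrable.intros simp: has_bochner_integral_integral_eq)
  also have "\<dots> = ((\<integral>x. (cmod (f x))\<^sup>2 \<partial>lborel) + 1) / r"
    using r by (simp add: add_divide_distrib)
  finally show "cmod (laplace f s) \<le> ((\<integral>x. (cmod (f x))\<^sup>2 \<partial>lborel) + 1) / sqrt \<bar>Re s\<bar>"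
    by (simp add: r_def)
qed

lemma integrable_lborel_shift:
  fixes f :: "real \<Rightarrow> 'a :: {banach, second_countable_topology}"
  assumes "integrable lborel f"
  shows "integrable lborel (\<lambda>x. f (x - t))"
  using lborel_integrable_real_affine[OF assms, of 1 "- t"] by simp

lemma laplace_sum_shift:
  fixes f :: "real \<Rightarrow> complex"
  assumes "finite I" "integrable lborel (\<lambda>x. f x * exp (- (s * of_real x)))"
  shows "laplace (\<lambda>x. \<Sum>i\<in>I. c i * f (x - a i)) s
    = (\<Sum>i\<in>I. c i * exp (- (s * of_real (a i)))) * laplace f s"
proof -
  have "integrable lborel (\<lambda>x. f (x - a i) * exp (- (s * of_real x)))" for i
  proof -
    have eq: "f (x - a i) * exp (- (s * of_real x))
        = f (x - a i) * exp (- (s * of_real (x - a i))) * exp (- (s * of_real (a i)))" for x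
      by (simp add: mult_exp_exp ring_distribs)
    show ?thesis
      unfolding eq by (intro integrable_mult_left integrable_lborel_shift[OF assms(2), of "a i"])
  qed
  then have "laplace (\<lambda>x. \<Sum>i\<in>I. c i * f (x - a i)) s = (\<Sum>i\<in>I. c i * laplace (\<lambda>x. f (x - a i)) s)"
    by (simp add: laplace_def sum_distrib_right mult.assoc)
  then show ?thesis
    by (simp add: laplace_shift sum_distrib_right mult.assoc)
qed

section \<open>Translates of a square-integrable function\<close>

text \<open>The Laplace transforms of the two halves of \<open>g\<close> both continue the same quotient of entire
  functions; it obeys the bound on either side of the imaginary axis and hence vanishes.\<close>
lemma L2_translates_eq_0_gap:
  fixes g :: "real \<Rightarrow> complex" and a :: "'i \<Rightarrow> real"
  assumes g [measurable]: "g \<in> borel_measurable borel" and L2: "integrable lborel (\<lambda>x. (cmod (g x))\<^sup>2)"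
    and I: "finite I" "inj_on a I"
    and zero: "AE x in lborel. (\<Sum>i\<in>I. c i * g (x - a i)) = 0"
    and i0: "i0 \<in> I" "c i0 \<noteq> 0" and gap: "\<And>i. i \<in> I \<Longrightarrow> i \<noteq> i0 \<Longrightarrow> a i \<ge> a i0 + \<delta>"
  shows "AE x in lborel. 0 < x \<and> x < \<delta> \<longrightarrow> g x = 0"
proof -
  define gp gm where "gp = (\<lambda>x. if x > 0 then g x else 0)" and "gm = (\<lambda>x. if x > 0 then 0 else g x)"
  have [measurable]: "gp \<in> borel_measurable borel" "gm \<in> borel_measurable borel"
    by (simp_all add: gp_def gm_def)
  have L2pm: "integrable lborel (\<lambda>x. (cmod (gp x))\<^sup>2)" "integrable lborel (\<lambda>x. (cmod (gm x))\<^sup>2)"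
    by (rule Bochner_Integration.integrable_bound[OF L2]; simp add: gp_def gm_def)+
  define B where "B = (\<integral>x. (cmod (g x))\<^sup>2 \<partial>lborel)"
  have Bpm: "(\<integral>x. (cmod (gp x))\<^sup>2 \<partial>lborel) \<le> B" "(\<integral>x. (cmod (gm x))\<^sup>2 \<partial>lborel) \<le> B"
    unfolding B_def by (rule integral_mono; use L2 L2pm in \<open>auto simp: gp_def gm_def\<close>)+
  define A where "A = (\<Sum>i\<in>I. \<bar>a i\<bar>)"
  have A: "\<bar>a i\<bar> \<le> A" if "i \<in> I" for i
    unfolding A_def using I(1) that by (intro member_le_sum) auto
  have "A \<ge> 0" by (simp add: A_def sum_nonneg)
  \<comment> \<open>Beyond \<open>A\<close> every \<open>x - a i\<close> is positive and the
    combination of \<open>gp\<close> is the given relation; below \<open>- A\<close> it vanishes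
    termwise. The cutoff turns this almost-everywhere support statement into the pointwise one of
    \<open>laplace_entire\<close>.\<close>
  define h where "h = (\<lambda>x. if \<bar>x\<bar> \<le> A then \<Sum>i\<in>I. c i * gp (x - a i) else 0)"
  have [measurable]: "h \<in> borel_measurable borel" by (simp add: h_def)
  have hp: "AE x in lborel. h x = (\<Sum>i\<in>I. c i * gp (x - a i))"
    using zero
  proof eventually_elim
    case (elim x)
    consider "\<bar>x\<bar> \<le> A" | "x > A" | "x < - A" by linarith
    then show ?case
    proof cases
      case 2
      have "gp (x - a i) = g (x - a i)" if "i \<in> I" for i
        using A[OF that] 2 by (auto simp: gp_def)
      with 2 elim \<open>A \<ge> 0\<close> show ?thesis by (simp add: h_def)
    next
      case 3
      have "gp (x - a i) = 0" if "i \<in> I" for i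
        using A[OF that] 3 by (auto simp: gp_def)
      with 3 \<open>A \<ge> 0\<close> show ?thesis by (simp add: h_def)
    qed (simp add: h_def)
  qed
  have hm: "AE x in lborel. h x = (\<Sum>i\<in>I. - c i * gm (x - a i))"
    using hp zero
  proof eventually_elim
    case (elim x)
    have "g y = gp y + gm y" for y by (simp add: gp_def gm_def)
    with elim show ?case
      by (simp add: ring_distribs sum.distrib sum_negf add_eq_0_iff)
  qed
  have ind: "integrable lborel (indicat_real {- A..A})"
    using \<open>A \<ge> 0\<close> by (intro integrable_real_indicator) auto
  have h: "integrable lborel h"
  proof (rule Bochner_Integration.integrable_bound)
    show "integrable lborel (\<lambda>x. \<Sum>i\<in>I. cmod (c i) * (indicator {- A..A} x + (cmod (gp (x - a i)))\<^sup>2))"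
      using integrable_lborel_shift[OF L2pm(1)] ind
      by (intro Bochner_Integration.integrable_sum integrable_mult_right Bochner_Integration.integrable_add) auto
    show "AE x in lborel. norm (h x)
        \<le> norm (\<Sum>i\<in>I. cmod (c i) * (indicator {- A..A} x + (cmod (gp (x - a i)))\<^sup>2))"
    proof (intro AE_I2)
      fix x
      \<comment> \<open>On a bounded interval this turns square integrability into
        integrability.\<close>
      have *: "t \<le> 1 + t\<^sup>2" for t :: real
        using sum_squares_bound[of t 1] zero_le_power2[of t] unfolding power_one mult_1_right by linarith
      have "norm (h x) \<le> (\<Sum>i\<in>I. cmod (c i) * (indicator {- A..A} x + (cmod (gp (x - a i)))\<^sup>2))"
      proof (cases "\<bar>x\<bar> \<le> A")
        case True
        have "norm (h x) \<le> (\<Sum>i\<in>I. cmod (c i) * cmod (gp (x - a i)))"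
          using True by (auto simp: h_def norm_mult intro!: order_trans[OF norm_sum])
        also have "\<dots> \<le> (\<Sum>i\<in>I. cmod (c i) * (1 + (cmod (gp (x - a i)))\<^sup>2))"
          by (intro sum_mono mult_left_mono *) simp
        finally show ?thesis using True by (simp add: indicator_def abs_le_iff)
      qed (auto simp: h_def intro!: sum_nonneg)
      then show "norm (h x) \<le> norm (\<Sum>i\<in>I. cmod (c i) * (indicator {- A..A} x + (cmod (gp (x - a i)))\<^sup>2))"
        by simp
    qed
  qed measurable
  define P where "P = (\<lambda>s. \<Sum>i\<in>I. c i * exp (- (s * of_real (a i))))"
  have laplace_cong: "laplace h s = laplace k s"
    if "AE x in lborel. h x = k x" and [measurable]: "k \<in> borel_measurable borel" for k s
    unfolding laplace_def by (intro integral_cong_AE) (use that(1) in \<open>auto elim: eventually_mono\<close>)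
  have bound: "cmod (laplace h s) \<le> cmod (P s) * ((B + 1) / sqrt \<bar>Re s\<bar>)" if s: "Re s \<noteq> 0" for s
  proof (cases "Re s > 0")
    case True
    have supp: "\<And>x. gp x \<noteq> 0 \<Longrightarrow> Re s * x \<ge> 0"
      using True by (auto simp: gp_def split: if_splits)
    have "laplace h s = P s * laplace gp s"
      unfolding P_def
      by (subst laplace_cong[OF hp], measurable)
         (intro laplace_sum_shift I laplace_integrable_half_line L2pm supp s, measurable)
    moreover have "cmod (laplace gp s) \<le> (B + 1) / sqrt \<bar>Re s\<bar>"
      by (rule order_trans[OF cmod_laplace_half_line_le[OF _ L2pm(1) supp s]])
         (use Bpm in \<open>auto intro!: divide_right_mono\<close>)
    ultimately show ?thesis
      by (simp only: norm_minus_cancel norm_mult mult_left_mono norm_ge_zero)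
  next
    case False
    have supp: "\<And>x. gm x \<noteq> 0 \<Longrightarrow> Re s * x \<ge> 0"
      using False by (auto simp: gm_def mult_nonpos_nonpos split: if_splits)
    have "laplace h s = (\<Sum>i\<in>I. - c i * exp (- (s * of_real (a i)))) * laplace gm s"
      by (subst laplace_cong[OF hm], measurable)
         (intro laplace_sum_shift I laplace_integrable_half_line L2pm supp s, measurable)
    then have "laplace h s = - (P s * laplace gm s)"
      by (simp add: P_def sum_negf)
    moreover have "cmod (laplace gm s) \<le> (B + 1) / sqrt \<bar>Re s\<bar>"
      by (rule order_trans[OF cmod_laplace_half_line_le[OF _ L2pm(2) supp s]])
         (use Bpm in \<open>auto intro!: divide_right_mono\<close>)
    ultimately show ?thesis
      by (simp only: norm_minus_cancel norm_mult mult_left_mono norm_ge_zero)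
  qed
  \<comment> \<open>On the imaginary axis \<open>P\<close> is a trigonometric polynomial with the
    distinct frequencies \<open>a i\<close>, so it is not identically zero.\<close>
  obtain x where "(\<Sum>i\<in>I. c i * cis (a i * x)) \<noteq> 0"
    using trig_poly_nonzero[where J = I and b = a and c = c and j = i0] I i0 by blast
  then have "P (- (\<i> * of_real x)) \<noteq> 0"
    by (simp add: P_def cis_conv_exp mult_ac)
  moreover have "P holomorphic_on UNIV"
    unfolding P_def by (intro holomorphic_intros)
  moreover have "laplace h holomorphic_on UNIV"
    using h \<open>A \<ge> 0\<close> by (intro laplace_entire[where A = A]) (auto simp: h_def)
  ultimately have "laplace h s = 0" for s
    using bound by (intro entire_dominated_eq_0[of P]) auto
  \<comment> \<open>At \<open>s = - (\<i> * of_real t)\<close> the Laplace transform of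
    \<open>h\<close> is its Fourier transform at \<open>t\<close>.\<close>
  then have "(\<integral>x. h x * iexp (t * x) \<partial>lborel) = 0" for t
    by (auto simp: laplace_def mult_ac dest: meta_spec[where x = "- (\<i> * of_real t)"])
  from fourier_eq_0[OF h this] have "AE x in lborel. h x = 0" .
  with hp have "AE x in lborel. 0 < x - a i0 \<and> x - a i0 < \<delta> \<longrightarrow> g (x - a i0) = 0"
  proof eventually_elim
    case (elim x)
    show ?case
    proof
      assume x: "0 < x - a i0 \<and> x - a i0 < \<delta>"
      \<comment> \<open>Only the leftmost translate of \<open>gp\<close> is alive in this window;
        the others start at \<open>a i0 + \<delta>\<close> or later.\<close>
      have "gp (x - a i) = 0" if "i \<in> I - {i0}" for i
        using gap[of i] that x by (auto simp: gp_def)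
      then have "(\<Sum>i\<in>I. c i * gp (x - a i)) = c i0 * g (x - a i0)"
        using I(1) i0(1) x by (simp add: sum.remove[of I i0] gp_def)
      with elim i0(2) show "g (x - a i0) = 0" by simp
    qed
  qed
  then show ?thesis
    using AE_lborel_shift_iff[of "\<lambda>x. 0 < x \<and> x < \<delta> \<longrightarrow> g x = 0" "a i0"] by simp
qed

text \<open>With \<open>i0\<close> the leftmost shift of nonzero coefficient and
  \<open>\<delta>\<close> the distance to the next one, \<open>L2_translates_eq_0_gap\<close> kills
  \<open>g\<close> on a window of length \<open>\<delta>\<close>. The relation is inherited by every
  translate of \<open>g\<close>, so the window may be placed anywhere, and countably many windows
  cover the line.\<close>

lemma L2_translates_independent:
  fixes g :: "real \<Rightarrow> complex" and a :: "'i \<Rightarrow> real"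
  assumes g [measurable]: "g \<in> borel_measurable borel" and L2: "integrable lborel (\<lambda>x. (cmod (g x))\<^sup>2)"
    and I: "finite I" "inj_on a I" and c: "i \<in> I" "c i \<noteq> 0"
    and zero: "AE x in lborel. (\<Sum>i\<in>I. c i * g (x - a i)) = 0"
  shows "AE x in lborel. g x = 0"
proof -
  define J where "J = {i\<in>I. c i \<noteq> 0}"
  have J: "finite J" "J \<noteq> {}" "inj_on a J"
    using I c by (auto simp: J_def inj_on_def)
  have zeroJ: "AE x in lborel. (\<Sum>i\<in>J. c i * g (x - a i)) = 0"
    using zero
  proof eventually_elim
    case (elim x)
    moreover have "(\<Sum>i\<in>J. c i * g (x - a i)) = (\<Sum>i\<in>I. c i * g (x - a i))"
      unfolding J_def by (intro sum.mono_neutral_left I) auto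
    ultimately show ?case by simp
  qed
  obtain i0 where i0: "i0 \<in> J" "\<And>i. i \<in> J \<Longrightarrow> a i0 \<le> a i"
    using arg_min_if_finite[OF J(1,2), of a] by (metis not_le_imp_less)
  obtain \<delta> where \<delta>: "\<delta> > 0" "\<And>i. i \<in> J \<Longrightarrow> i \<noteq> i0 \<Longrightarrow> a i \<ge> a i0 + \<delta>"
  proof (cases "J = {i0}")
    case True
    then show ?thesis by (intro that[of 1]) auto
  next
    case False
    let ?d = "Min ((\<lambda>i. a i - a i0) ` (J - {i0}))"
    have fin: "finite ((\<lambda>i. a i - a i0) ` (J - {i0}))" "(\<lambda>i. a i - a i0) ` (J - {i0}) \<noteq> {}"
      using J i0 False by auto
    have "a i0 < a i" if "i \<in> J - {i0}" for i
      using i0 J(3) that by (force simp: inj_on_def less_le)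
    then have "?d > 0" using fin by simp
    moreover have "a i \<ge> a i0 + ?d" if "i \<in> J" "i \<noteq> i0" for i
      using Min_le[OF fin(1), of "a i - a i0"] that by force
    ultimately show ?thesis using that by blast
  qed
  have loc: "AE x in lborel. t < x \<and> x < t + \<delta> \<longrightarrow> g x = 0" for t
  proof -
    have "AE x in lborel. 0 < x \<and> x < \<delta> \<longrightarrow> g (x + t) = 0"
    proof (rule L2_translates_eq_0_gap[OF _ _ J(1,3) _ i0(1) _ \<delta>(2)])
      show "integrable lborel (\<lambda>x. (cmod (g (x + t)))\<^sup>2)"
        using integrable_lborel_shift[OF L2, of "- t"] by simp
      show "AE x in lborel. (\<Sum>i\<in>J. c i * g (x - a i + t)) = 0"
        using AE_lborel_shift[OF zeroJ, of "- t"] by (simp add: algebra_simps)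
      show "c i0 \<noteq> 0" using i0(1) by (simp add: J_def)
    qed measurable
    from AE_lborel_shift[OF this, of t] show ?thesis
      by eventually_elim auto
  qed
  \<comment> \<open>The windows are open; advancing by half their length makes them overlap, so that
    endpoints are covered too.\<close>
  have "AE x in lborel. \<forall>n::int. of_int n * (\<delta> / 2) < x \<and> x < of_int n * (\<delta> / 2) + \<delta> \<longrightarrow> g x = 0"
    unfolding AE_all_countable by (intro allI loc)
  then show ?thesis
  proof eventually_elim
    case (elim x)
    \<comment> \<open>The ceiling minus one, unlike the floor, gives the strict inequality at the
      left end.\<close>
    define n where "n = \<lceil>x / (\<delta> / 2)\<rceil> - 1"
    have "of_int n < x / (\<delta> / 2)" "x / (\<delta> / 2) \<le> of_int n + 1"
      unfolding n_def by linarith+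
    then have "of_int n * (\<delta> / 2) < x" "x \<le> (of_int n + 1) * (\<delta> / 2)"
      using \<delta>(1) by (simp_all add: field_simps)
    moreover have "(of_int n + 1) * (\<delta> / 2) < of_int n * (\<delta> / 2) + \<delta>"
      using \<delta>(1) by (simp add: algebra_simps)
    ultimately show ?case using elim by fastforce
  qed
qed

section \<open>Gabor relations\<close>

lemma eventually_at_top_shift:
  fixes t :: real
  assumes "\<forall>\<^sub>F x in at_top. P x"
  shows "\<forall>\<^sub>F x in at_top. P (x - t)"
proof -
  obtain x0 where "\<And>x. x > x0 \<Longrightarrow> P x"
    using assms by (auto simp: eventually_at_top_dense)
  then show ?thesis
    unfolding eventually_at_top_dense by (intro exI[of _ "x0 + t"]) auto
qed

text \<open>For \<open>x > b + m\<close> all points \<open>x - a i\<close> lie beyond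
  \<open>b\<close>, where \<open>v\<close> may be exchanged for \<open>g\<close>.\<close>

lemma AE_translates_eq_0:
  fixes v g :: "real \<Rightarrow> complex"
  assumes I: "finite I" and eq: "AE x in lborel. x > b \<longrightarrow> v x = g x"
    and le: "\<And>i. i \<in> I \<Longrightarrow> a i \<le> m" and zero: "\<And>x. x > b + m \<Longrightarrow> (\<Sum>i\<in>I. c i * v (x - a i)) = 0"
  shows "AE x in lborel. x > b + m \<longrightarrow> (\<Sum>i\<in>I. c i * g (x - a i)) = 0"
proof -
  have "AE x in lborel. \<forall>i\<in>I. x - a i > b \<longrightarrow> v (x - a i) = g (x - a i)"
    using I AE_lborel_shift[OF eq] by (intro AE_finite_allI) auto
  then show ?thesis
  proof eventually_elim
    case (elim x)
    show ?case
    proof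
      assume x: "x > b + m"
      then have "(\<Sum>i\<in>I. c i * g (x - a i)) = (\<Sum>i\<in>I. c i * v (x - a i))"
        using elim le by (intro sum.cong) force+
      then show "(\<Sum>i\<in>I. c i * g (x - a i)) = 0"
        using zero x by simp
    qed
  qed
qed

text \<open>An analytic function \<open>v\<close> that represents \<open>g\<close> beyond \<open>B\<close> is continued to the left by the gap \<open>\<delta>\<close>
  below the largest shift \<open>m\<close>, solving for the term of \<open>i0\<close> in the relation of frequency \<open>b i0\<close>. The
  continuation \<open>w\<close> satisfies the full relation, so that \<open>w - g\<close> is annihilated by a nonzero
  trigonometric polynomial.\<close>
lemma gabor_relation_split:
  fixes g :: "real \<Rightarrow> complex" and a b :: "'i \<Rightarrow> real" and c :: "'i \<Rightarrow> complex"
  defines "S \<equiv> \<lambda>I \<beta>. {i\<in>I. b i = \<beta>}"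
  assumes I: "finite I" "inj_on (\<lambda>i. (a i, b i)) I" "\<And>i. i \<in> I \<Longrightarrow> c i \<noteq> 0"
    and g: "analytic_beyond A g"
    and zero: "AE x in lborel. (\<Sum>i\<in>I. c i * cis (b i * x) * g (x - a i)) = 0"
    and ult: "\<And>\<beta>. \<beta> \<in> b ` I \<Longrightarrow> \<forall>\<^sub>F x in at_top. (\<Sum>i\<in>S I \<beta>. c i * g (x - a i)) = 0"
    and \<beta>: "\<beta> \<in> b ` I"
  shows "AE x in lborel. (\<Sum>i\<in>S I \<beta>. c i * g (x - a i)) = 0"
proof -
  define m where "m = Max (a ` I)"
  have le_m: "a i \<le> m" if "i \<in> I" for i
    unfolding m_def using I(1) that by simp
  have "m \<in> a ` I" unfolding m_def using I(1) \<beta> by (intro Max_in) auto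
  then obtain i0 where i0: "i0 \<in> I" "a i0 = m" by auto
  obtain \<delta> where \<delta>: "\<delta> > 0" "\<And>i. i \<in> I \<Longrightarrow> a i < m \<Longrightarrow> a i \<le> m - \<delta>"
  proof (cases "\<exists>i\<in>I. a i < m")
    case True
    define D where "D = (\<lambda>i. m - a i) ` {i\<in>I. a i < m}"
    have D: "finite D" "D \<noteq> {}" using I(1) True by (auto simp: D_def)
    show ?thesis
    proof (rule that)
      show "Min D > 0" using D by (auto simp: D_def)
      show "a i \<le> m - Min D" if "i \<in> I" "a i < m" for i
        using Min_le[OF D(1), of "m - a i"] that by (force simp: D_def)
    qed
  qed (use that[of 1] in auto)
  have finS: "finite (S I \<gamma>)" and S_I: "\<And>i. i \<in> S I \<gamma> \<Longrightarrow> i \<in> I" for \<gamma>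
    using I(1) by (auto simp: S_def)
  \<comment> \<open>The identity theorem extends each single-frequency relation from a neighbourhood
    of infinity to the whole ray where all translates of \<open>v\<close> are analytic.\<close>
  have vanish: "(\<Sum>i\<in>S I \<gamma>. c i * v (x - a i)) = 0"
    if v: "analytic_beyond B v" "\<forall>\<^sub>F x in at_top. v x = g x" and "\<gamma> \<in> b ` I" "x > B + m" for v B \<gamma> x
  proof (rule analytic_beyond_eq_0[OF _ _ \<open>x > B + m\<close>])
    show "analytic_beyond (B + m) (\<lambda>x. \<Sum>i\<in>S I \<gamma>. c i * v (x - a i))"
      by (intro analytic_beyond_sum analytic_beyond_cmult analytic_beyond_mono[OF analytic_beyond_shift[OF v(1)]])
         (use le_m S_I in auto)
    have "\<forall>\<^sub>F x in at_top. \<forall>i\<in>S I \<gamma>. v (x - a i) = g (x - a i)"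
      by (intro eventually_ball_finite finS ballI eventually_at_top_shift v(2))
    with ult[OF \<open>\<gamma> \<in> b ` I\<close>] show "\<forall>\<^sub>F x in at_top. (\<Sum>i\<in>S I \<gamma>. c i * v (x - a i)) = 0"
      by eventually_elim simp
  qed
  \<comment> \<open>The almost-everywhere agreement is what gets extended to the left; the pointwise
    agreement near infinity is what \<open>vanish\<close> requires.\<close>
  define good where "good B \<longleftrightarrow> (\<exists>v. analytic_beyond B v \<and>
    (AE x in lborel. x > B \<longrightarrow> v x = g x) \<and> (\<forall>\<^sub>F x in at_top. v x = g x))" for B
  have step: "good (B - \<delta>)" if "good B" for B
  proof -
    obtain v where v: "analytic_beyond B v" "AE x in lborel. x > B \<longrightarrow> v x = g x"
      "\<forall>\<^sub>F x in at_top. v x = g x"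
      using \<open>good B\<close> by (auto simp: good_def)
    define R where "R = S I (b i0) - {i0}"
    have R: "finite R" "i0 \<in> S I (b i0)" using finS i0 by (auto simp: R_def S_def)
    \<comment> \<open>Members of \<open>R\<close> share the frequency of \<open>i0\<close>, so
      distinctness of the pairs forces their shifts to differ from \<open>m\<close>.\<close>
    have R_le: "a i \<le> m - \<delta>" if "i \<in> R" for i
    proof -
      have "i \<in> I" "b i = b i0" "i \<noteq> i0" using that by (auto simp: R_def S_def)
      with I(2) i0 have "a i \<noteq> m" by (auto simp: inj_on_def)
      with le_m[OF \<open>i \<in> I\<close>] have "a i < m" by simp
      with \<delta>(2) \<open>i \<in> I\<close> show ?thesis by blast
    qed
    \<comment> \<open>This solves the relation at \<open>x = y + m\<close> for the term of
      \<open>i0\<close>. The arguments on the right lie at least \<open>\<delta>\<close> beyond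
      \<open>y\<close>, so \<open>v\<close> is known there as soon as
      \<open>y > B - \<delta>\<close>.\<close>
    define w where "w = (\<lambda>y. - (1 / c i0) * (\<Sum>i\<in>R. c i * v (y - (a i - m))))"
    have w: "analytic_beyond (B - \<delta>) w"
      unfolding w_def
      by (intro analytic_beyond_cmult analytic_beyond_sum analytic_beyond_mono[OF analytic_beyond_shift[OF v(1)]])
         (use R_le in force)
    have wv: "w y = v y" if "y > B" for y
    proof -
      have "(\<Sum>i\<in>S I (b i0). c i * v (y + m - a i)) = 0"
        by (rule vanish[OF v(1,3)]) (use i0 that in auto)
      then have "c i0 * v y + (\<Sum>i\<in>R. c i * v (y + m - a i)) = 0"
        using sum.remove[OF finS R(2), of "\<lambda>i. c i * v (y + m - a i)"] i0 by (simp add: R_def)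
      then have "w y = (1 / c i0) * (c i0 * v y)"
        unfolding w_def diff_diff_eq2 by (simp add: add_eq_0_iff2)
      then show ?thesis using I(3) i0 by simp
    qed
    have w_ult: "\<forall>\<^sub>F x in at_top. w x = g x"
      using v(3) eventually_gt_at_top[of B] by eventually_elim (simp add: wv)
    have w_AE: "AE x in lborel. x > B \<longrightarrow> w x = g x"
      using v(2) by eventually_elim (simp add: wv)
    have w_zero: "(\<Sum>i\<in>I. c i * cis (b i * x) * w (x - a i)) = 0" if "x > B - \<delta> + m" for x
    proof -
      have "(\<Sum>i\<in>I. c i * cis (b i * x) * w (x - a i))
          = (\<Sum>\<gamma>\<in>b ` I. \<Sum>i\<in>S I \<gamma>. c i * cis (b i * x) * w (x - a i))"
        unfolding S_def by (rule sum.image_gen[OF I(1)])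
      also have "\<dots> = (\<Sum>\<gamma>\<in>b ` I. cis (\<gamma> * x) * (\<Sum>i\<in>S I \<gamma>. c i * w (x - a i)))"
        unfolding sum_distrib_left by (intro sum.cong refl) (simp add: S_def)
      also have "\<dots> = 0"
        using vanish[OF w w_ult _ that] by (intro sum.neutral) auto
      finally show ?thesis .
    qed
    \<comment> \<open>These are the terms whose argument may lie to the left of \<open>B\<close>.
      Their frequencies are distinct because their shifts agree, so the sum of their exponentials is
      nonzero almost everywhere.\<close>
    define M where "M = {i\<in>I. a i = m}"
    have M: "finite M" "inj_on b M" "i0 \<in> M" "M \<subseteq> I"
      using I i0 by (auto simp: M_def inj_on_def)
    have "AE x in lborel. \<forall>i\<in>I. x - a i > B \<longrightarrow> w (x - a i) = g (x - a i)"
      using I(1) AE_lborel_shift[OF w_AE] by (intro AE_finite_allI) auto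
    moreover have "AE x in lborel. (\<Sum>i\<in>M. c i * cis (b i * x)) \<noteq> 0"
      by (rule AE_trig_poly_nonzero[where j = i0]) (use M I(3) i0 in auto)
    ultimately have "AE x in lborel. x - m > B - \<delta> \<longrightarrow> w (x - m) = g (x - m)"
      using zero
    proof eventually_elim
      case (elim x)
      show ?case
      proof
        assume x: "x - m > B - \<delta>"
        define d where "d = (\<lambda>y. w y - g y)"
        have "0 = (\<Sum>i\<in>I. c i * cis (b i * x) * d (x - a i))"
          using elim(3) w_zero[of x] x by (simp add: d_def right_diff_distrib sum_subtractf)
        also have "\<dots> = (\<Sum>i\<in>M. c i * cis (b i * x) * d (x - a i))"
        proof (rule sum.mono_neutral_right[OF I(1) M(4)], intro ballI)
          fix i assume i: "i \<in> I - M"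
          then have "a i < m" using le_m[of i] by (auto simp: M_def less_le)
          then have "a i \<le> m - \<delta>" using \<delta>(2) i by blast
          then have "x - a i > B" using x by linarith
          then show "c i * cis (b i * x) * d (x - a i) = 0"
            using elim(1) i by (simp add: d_def)
        qed
        also have "\<dots> = (\<Sum>i\<in>M. c i * cis (b i * x)) * d (x - m)"
          unfolding sum_distrib_right by (intro sum.cong refl) (simp add: M_def)
        finally show "w (x - m) = g (x - m)"
          using elim(2) by (simp add: d_def)
      qed
    qed
    then have "AE x in lborel. x > B - \<delta> \<longrightarrow> w x = g x"
      using AE_lborel_shift_iff[of "\<lambda>x. x > B - \<delta> \<longrightarrow> w x = g x" m] by simp
    with w w_ult show ?thesis by (auto simp: good_def)
  qed
  have good: "good (A - real n * \<delta>)" for n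
  proof (induction n)
    case 0
    show ?case unfolding good_def using g by (intro exI[of _ g]) auto
  next
    case (Suc n)
    from step[OF this] show ?case by (simp add: algebra_simps)
  qed
  have "AE x in lborel. x > A - real n * \<delta> + m \<longrightarrow> (\<Sum>i\<in>S I \<beta>. c i * g (x - a i)) = 0" for n
  proof -
    obtain v where v: "analytic_beyond (A - real n * \<delta>) v"
      "AE x in lborel. x > A - real n * \<delta> \<longrightarrow> v x = g x" "\<forall>\<^sub>F x in at_top. v x = g x"
      using good[of n] by (auto simp: good_def)
    show ?thesis
      by (rule AE_translates_eq_0[OF finS v(2)]) (use le_m S_I vanish[OF v(1,3) \<beta>] in auto)
  qed
  then have "AE x in lborel. \<forall>n. x > A - real n * \<delta> + m \<longrightarrow> (\<Sum>i\<in>S I \<beta>. c i * g (x - a i)) = 0"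
    unfolding AE_all_countable by blast
  then show ?thesis
  proof eventually_elim
    case (elim x)
    obtain n where "A + m - x < real n * \<delta>"
      using reals_Archimedean3[OF \<delta>(1)] by blast
    then have "x > A - real n * \<delta> + m" by linarith
    with elim show ?case by blast
  qed
qed

section \<open>Application to translation-invariant spaces of Hardy-field functions\<close>

text \<open>The functions with both parts in \<open>E\<close> form a complex subspace containing the
  generators: multiplication by a complex scalar only mixes the two parts by real
  combinations.\<close>

lemma complexification_Re_Im:
  fixes E :: "('a \<Rightarrow> real) set"
  assumes E: "fun_space.subspace E" and f: "f \<in> complexification E"
  shows "(\<lambda>x. Re (f x)) \<in> E \<and> (\<lambda>x. Im (f x)) \<in> E"
proof -
  let ?V = "{f. (\<lambda>x. Re (f x)) \<in> E \<and> (\<lambda>x. Im (f x)) \<in> E}"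
  have E0: "(\<lambda>x. 0) \<in> E"
    using fun_space.subspace_0[OF E] by (simp add: zero_fun_def)
  have Eadd: "(\<lambda>x. u x + w x) \<in> E" if "u \<in> E" "w \<in> E" for u w
    using fun_space.subspace_add[OF E that] by (simp add: plus_fun_def)
  have Escale: "(\<lambda>x. r * u x) \<in> E" if "u \<in> E" for u r
    using fun_space.subspace_scale[OF E that, of r] by (simp add: fun_scale_def)
  have Ediff: "(\<lambda>x. u x - w x) \<in> E" if "u \<in> E" "w \<in> E" for u w
    using Eadd[OF that(1) Escale[OF that(2), of "- 1"]] by simp
  have "fun_space.subspace ?V"
    unfolding fun_space.subspace_def
    using E0 Eadd Escale Ediff by (auto simp: zero_fun_def plus_fun_def fun_scale_def)
  moreover have "(\<lambda>f x. complex_of_real (f x)) ` E \<subseteq> ?V"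
    using E0 by auto
  ultimately have "complexification E \<subseteq> ?V"
    unfolding complexification_def by (rule fun_space.span_minimal[rotated])
  with f show ?thesis by blast
qed

theorem theorem2p4:
  fixes E :: "(real \<Rightarrow> real) set" and H :: "germ set"
    and g :: "real \<Rightarrow> complex"
    and N :: nat and \<alpha> \<beta> :: "nat \<Rightarrow> real"
  assumes "fun_space.subspace E"
    and "hardy_field H"
    and "\<And>f. f \<in> E \<Longrightarrow> ultimately_analytic f \<and> germ f \<in> H"
    and "\<And>f a. f \<in> E \<Longrightarrow> (\<lambda>x. f (x - a)) \<in> E"
    and "g \<in> complexification E \<inter> L2"
    and "\<not> (AE x in lebesgue. g x = 0)"
    and "inj_on (\<lambda>k. (\<alpha> k, \<beta> k)) {1..N}"
  shows "L2_independent {1..N} (\<lambda>k. gabor g (\<alpha> k, \<beta> k))"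
  unfolding L2_independent_def
proof (intro allI impI ballI, rule ccontr)
  fix c :: "nat \<Rightarrow> complex" and k
  assume rel: "AE x in lebesgue. (\<Sum>i\<in>{1..N}. c i * gabor g (\<alpha> i, \<beta> i) x) = 0"
    and k: "k \<in> {1..N}" "c k \<noteq> 0"
  \<comment> \<open>Zero coefficients are dropped because the continuation divides by the
    coefficient of an index of largest shift.\<close>
  define I where "I = {i\<in>{1..N}. c i \<noteq> 0}"
  define b where "b = (\<lambda>i. 2 * pi * \<beta> i)"
  define S where "S = (\<lambda>\<gamma>. {i\<in>I. b i = \<gamma>})"
  define h where "h = (\<lambda>\<gamma> x. \<Sum>i\<in>S \<gamma>. c i * g (x - \<alpha> i))"
  have I: "finite I" "k \<in> I" "\<And>i. i \<in> I \<Longrightarrow> c i \<noteq> 0" "I \<subseteq> {1..N}"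
    using k by (auto simp: I_def)
  have inj: "inj_on (\<lambda>i. (\<alpha> i, b i)) I"
    using assms(7) I(4) by (auto simp: inj_on_def b_def)
  have zero: "AE x in lborel. (\<Sum>i\<in>I. c i * cis (b i * x) * g (x - \<alpha> i)) = 0"
    using rel unfolding AE_completion_iff
  proof eventually_elim
    case (elim x)
    have "(\<Sum>i\<in>I. c i * cis (b i * x) * g (x - \<alpha> i)) = (\<Sum>i\<in>{1..N}. c i * gabor g (\<alpha> i, \<beta> i) x)"
      by (intro sum.mono_neutral_cong_left)
         (auto simp: I_def gabor_def b_def cis_conv_exp mult_ac)
    with elim show ?case by simp
  qed
  have gE: "g \<in> complexification E" and gL2: "g \<in> L2"
    using assms(5) by auto
  have shift: "(\<lambda>x. Re (g (x - t))) \<in> E" "(\<lambda>x. Im (g (x - t))) \<in> E" for t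
    using complexification_Re_Im[OF assms(1) gE] assms(4) by auto
  have hE: "(\<lambda>x. Re (h \<gamma> x)) \<in> E \<and> (\<lambda>x. Im (h \<gamma> x)) \<in> E" for \<gamma>
  proof (rule complexification_Re_Im[OF assms(1)])
    have shift': "(\<lambda>x. g (x - t)) \<in> complexification E" for t
    proof -
      have base: "(\<lambda>x. complex_of_real (f x)) \<in> complexification E" if "f \<in> E" for f
        unfolding complexification_def using that by (intro fun_space.span_base) auto
      have "(\<lambda>x. of_real (Re (g (x - t)))) + fun_scale \<i> (\<lambda>x. of_real (Im (g (x - t)))) \<in> complexification E"
        using base[OF shift(1)] base[OF shift(2)] unfolding complexification_def
        by (intro fun_space.span_add fun_space.span_scale)
      moreover have "(\<lambda>x. of_real (Re (g (x - t)))) + fun_scale \<i> (\<lambda>x. of_real (Im (g (x - t)))) = (\<lambda>x. g (x - t))"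
        by (auto simp: fun_eq_iff fun_scale_def complex_eq_iff)
      ultimately show ?thesis by simp
    qed
    have "(\<lambda>x. \<Sum>i\<in>T. c i * g (x - \<alpha> i)) \<in> complexification E" if "finite T" for T
      using that
    proof (induction T rule: finite_induct)
      case empty
      show ?case
        using fun_space.span_zero unfolding complexification_def by (simp add: zero_fun_def)
    next
      case (insert i T)
      then have "fun_scale (c i) (\<lambda>x. g (x - \<alpha> i)) + (\<lambda>x. \<Sum>i\<in>T. c i * g (x - \<alpha> i)) \<in> complexification E"
        using shift' unfolding complexification_def by (intro fun_space.span_add fun_space.span_scale) auto
      with insert.hyps show ?case
        by (simp add: plus_fun_def fun_scale_def)
    qed
    then show "h \<gamma> \<in> complexification E"
      using I(1) unfolding h_def by (simp add: S_def)
  qed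
  have ult: "\<forall>\<^sub>F x in at_top. h \<gamma> x = 0" if "\<gamma> \<in> b ` I" for \<gamma>
  proof (rule hardy_field_trig_independent[OF assms(2), where b = "\<lambda>\<gamma>. \<gamma>" and J = "b ` I"])
    define F where "F = (\<lambda>x. \<Sum>\<gamma>\<in>b ` I. h \<gamma> x * cis (\<gamma> * x))"
    show germs: "germ (\<lambda>x. Re (h \<gamma> x)) \<in> H \<and> germ (\<lambda>x. Im (h \<gamma> x)) \<in> H" for \<gamma>
      using hE assms(3) by blast
    \<comment> \<open>The relation holds only almost everywhere; continuity near infinity, from the
      differentiability of Hardy-field elements, makes it hold at every large
      \<open>x\<close>.\<close>
    have "\<forall>\<^sub>F x in at_top. isCont (h \<gamma>) x" for \<gamma>
      using hardy_fieldD(3)[OF assms(2) conjunct1[OF germs[of \<gamma>]]]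
        hardy_fieldD(3)[OF assms(2) conjunct2[OF germs[of \<gamma>]]]
    proof eventually_elim
      case (elim x)
      then have "isCont (\<lambda>x. Re (h \<gamma> x)) x" "isCont (\<lambda>x. Im (h \<gamma> x)) x"
        by (simp_all add: differentiable_imp_continuous_within)
      then show ?case by (simp add: isCont_def tendsto_complex_iff)
    qed
    then have "\<forall>\<^sub>F x in at_top. \<forall>\<gamma>\<in>b ` I. isCont (h \<gamma>) x"
      using I(1) by (intro eventually_ball_finite) auto
    then obtain x0 where x0: "\<And>x \<gamma>. x > x0 \<Longrightarrow> \<gamma> \<in> b ` I \<Longrightarrow> isCont (h \<gamma>) x"
      by (auto simp: eventually_at_top_dense)
    have cont: "isCont F x" if "x > x0" for x
      unfolding F_def cis_conv_exp using x0[OF that] by (intro continuous_intros) auto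
    have F_eq: "F x = (\<Sum>i\<in>I. c i * cis (b i * x) * g (x - \<alpha> i))" for x
    proof -
      have "F x = (\<Sum>\<gamma>\<in>b ` I. \<Sum>i\<in>S \<gamma>. c i * cis (b i * x) * g (x - \<alpha> i))"
        unfolding F_def h_def sum_distrib_right
        by (intro sum.cong refl) (simp add: S_def mult_ac)
      then show ?thesis
        unfolding S_def by (simp add: sum.image_gen[OF I(1), of _ b])
    qed
    from zero have "AE x in lborel. x > x0 \<longrightarrow> F x = 0"
      by eventually_elim (simp add: F_eq)
    from continuous_AE_eq_0[OF this cont] show "\<forall>\<^sub>F x in at_top. F x = 0"
      by (auto simp: eventually_at_top_dense)
  qed (use I that in auto)
  obtain A where A: "analytic_beyond A g"
  proof -
    from shift[of 0] assms(3) have "ultimately_analytic (\<lambda>x. Re (g x))" "ultimately_analytic (\<lambda>x. Im (g x))"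
      by auto
    then obtain A1 A2 where "real_analytic_on (\<lambda>x. Re (g x)) {A1<..}" "real_analytic_on (\<lambda>x. Im (g x)) {A2<..}"
      by (auto simp: ultimately_analytic_def)
    then have "analytic_beyond (max A1 A2) g"
      unfolding analytic_beyond_def by (auto elim!: real_analytic_on_subset)
    then show ?thesis by (rule that)
  qed
  have "AE x in lborel. (\<Sum>i\<in>S (b k). c i * g (x - \<alpha> i)) = 0"
    unfolding S_def
    by (rule gabor_relation_split[OF I(1) inj I(3) A zero])
       (use ult I(2) in \<open>auto simp: h_def S_def\<close>)
  \<comment> \<open>Membership in \<open>L2\<close> gives Lebesgue measurability, whereas the result
    on translates is stated for Borel functions.\<close>
  moreover obtain g' where g': "g' \<in> borel_measurable borel" "AE x in lborel. g x = g' x"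
  proof -
    have "(\<lambda>x. Re (g x)) \<in> borel_measurable lebesgue" "(\<lambda>x. Im (g x)) \<in> borel_measurable lebesgue"
      using gL2 by (auto simp: L2_def)
    then obtain u w where uw: "u \<in> borel_measurable lborel" "AE x in lborel. Re (g x) = u x"
      "w \<in> borel_measurable lborel" "AE x in lborel. Im (g x) = w x"
      using completion_ex_borel_measurable_real by metis
    show ?thesis
    proof (rule that)
      show "(\<lambda>x. Complex (u x) (w x)) \<in> borel_measurable borel"
        using uw(1,3) unfolding Complex_eq by simp
      show "AE x in lborel. g x = Complex (u x) (w x)"
        using uw(2,4) by eventually_elim (simp add: complex_eq_iff)
    qed
  qed
  have "AE x in lborel. \<forall>i\<in>S (b k). g (x - \<alpha> i) = g' (x - \<alpha> i)"
    using AE_lborel_shift[OF g'(2)] I(1) by (intro AE_finite_allI) (auto simp: S_def)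
  ultimately have zero': "AE x in lborel. (\<Sum>i\<in>S (b k). c i * g' (x - \<alpha> i)) = 0"
    by eventually_elim simp
  have L2': "integrable lborel (\<lambda>x. (cmod (g' x))\<^sup>2)"
  proof -
    have "integrable lebesgue (\<lambda>x. (cmod (g' x))\<^sup>2)"
    proof (rule integrable_cong_AE_imp[of lebesgue "\<lambda>x. (cmod (g x))\<^sup>2"])
      show "integrable lebesgue (\<lambda>x. (cmod (g x))\<^sup>2)"
        using gL2 by (simp add: L2_def)
      show "(\<lambda>x. (cmod (g' x))\<^sup>2) \<in> borel_measurable lebesgue"
        using g'(1) by (intro measurable_completion) simp
      show "AE x in lebesgue. (cmod (g x))\<^sup>2 = (cmod (g' x))\<^sup>2"
        unfolding AE_completion_iff using g'(2) by eventually_elim simp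
    qed
    then show ?thesis
      using g'(1) by (subst (asm) integrable_completion) auto
  qed
  \<comment> \<open>Within one frequency the shifts are distinct since the pairs are, and
    \<open>k\<close> provides a nonzero coefficient.\<close>
  have "inj_on \<alpha> (S (b k))" "finite (S (b k))" "k \<in> S (b k)"
    using inj I by (auto simp: S_def inj_on_def)
  then have "AE x in lborel. g' x = 0"
    using L2_translates_independent[OF g'(1) L2' _ _ _ _ zero'] k(2) by blast
  with g'(2) have "AE x in lborel. g x = 0"
    by eventually_elim simp
  then show False
    using assms(6) by (simp add: AE_completion_iff)
qed

end
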